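(* Let $\gamma_1,\gamma_2$ be non-zero rational numbers, let $\theta\in[0,1]$, let $s,u>0$ satisfy $\frac{s}{2}+u>1$, and let $C,K_1,K_2\in(0,\infty)$. There exists $\varepsilon_*>0$, depending only on $C,K_1,K_2,s,u,\theta,\gamma_1,\gamma_2$, with the following property. Suppose $A\subset[0,1]$ is compact and supports a Borel probability measure $\mu$ such that (1) $\mathcal{J}_{s,\theta}(\mu)=K_1<\infty$ and $\mathcal{J}_{u,1-\frac{\theta}{2}}(\mu)=K_2<\infty$; and (2) $\mu(B(x,r))\le C r^{1-\varepsilon_0}$ for all $x\in\mathbb{R}$ and $r>0$, for some $0<\varepsilon_0\le\varepsilon_*$. Then there exist $x,t\in\mathbb{R}$ with $t\neq0$ such that $$\{x,\;x-\gamma_1t,\;x-\gamma_2t\}\subset A.$$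
   Context: For a finite Borel measure $\mu$ on $\mathbb{R}$ with Fourier transform $\widehat\mu$ and $s\ge0$, the $(s,\theta)$-energies are defined by $$\mathcal{J}_{s,\theta}(\mu)=\Big(\int_{\mathbb{R}}|\widehat{\mu}(\xi)|^{\frac{2}{\theta}}|\xi|^{\frac{s}{\theta}-1}\,d\xi\Big)^{\theta}\quad\text{for }\theta\in(0,1],\qquad \mathcal{J}_{s,0}(\mu)=\sup_{\xi\in\mathbb{R}}|\widehat{\mu}(\xi)|^2|\xi|^s.$$ $B(x,r)\subset\mathbb{R}$ is the ball (interval) of radius $r$ centred at $x$. "$A$ supports $\mu$" means that $\mu$ is a Borel probability measure with $\operatorname{supp}\mu\subset A$. *)

theory Defs
  imports "HOL-Probability.Probability"
begin

definition fourier_transform :: "real measure \<Rightarrow> real \<Rightarrow> complex" where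
  "fourier_transform \<mu> \<xi> = (CLINT x|\<mu>. iexp (- (2 * pi * \<xi> * x)))"

text \<open>Real powers of extended nonnegative reals, with \<^term>\<open>\<infinity>\<close> sent to \<^term>\<open>\<infinity>\<close>;
  only used for positive exponents.\<close>

definition ennreal_powr :: "ennreal \<Rightarrow> real \<Rightarrow> ennreal" where
  "ennreal_powr a p = (if a = \<infinity> then \<infinity> else ennreal (enn2real a powr p))"

text \<open>Meaningful for finite Borel measures on the line, \<open>s \<ge> 0\<close> and \<open>\<theta> \<in> [0,1]\<close>.
  Since \<open>0 powr a = 0\<close> for every \<open>a\<close>, the expressions are \<open>0\<close> at \<open>\<xi> = 0\<close>. This affects neither
  the integral (a null set) nor the supremum (for \<open>s > 0\<close> the value is \<open>0\<close> anyway, and for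
  \<open>s = 0\<close> the Fourier transform is continuous at \<open>0\<close>).\<close>

definition energy :: "real \<Rightarrow> real \<Rightarrow> real measure \<Rightarrow> ennreal" where
  "energy s \<theta> \<mu> =
    (if \<theta> = 0
     then (SUP \<xi>. ennreal ((cmod (fourier_transform \<mu> \<xi>))\<^sup>2 * \<bar>\<xi>\<bar> powr s))
     else ennreal_powr
            (\<integral>\<^sup>+ \<xi>. ennreal (cmod (fourier_transform \<mu> \<xi>) powr (2 / \<theta>)
                              * \<bar>\<xi>\<bar> powr (s / \<theta> - 1)) \<partial>lborel) \<theta>)"

definition measure_support :: "'a::topological_space measure \<Rightarrow> 'a set" where
  "measure_support \<mu> = {x. \<forall>U. open U \<longrightarrow> x \<in> U \<longrightarrow> emeasure \<mu> U > 0}"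

definition supports :: "real set \<Rightarrow> real measure \<Rightarrow> bool" where
  "supports A \<mu> \<longleftrightarrow> real_distribution \<mu> \<and> measure_support \<mu> \<subseteq> A"

end

theory Submission
  imports Defs
begin

text \<open>
  Clear denominators: the sought triples are the solutions of \<open>a x + b y + c z = 0\<close> with \<open>x \<noteq> y\<close> in \<open>A\<close>,
  for integers \<open>a + b + c = 0\<close>. With \<open>\<sigma> = s/2 + u - 1 > 0\<close>, Young's inequality turns the two energy bounds into
  \<open>\<integral> |\<mu>^|\<^sup>3 |\<xi>|\<^sup>\<sigma> \<le> B\<close>. Hence the smoothed counts
  \<open>\<Lambda>(\<delta>) = \<integral> g\<^sub>\<delta>(a x + b y + c z) d\<mu>\<^sup>3 = \<integral> \<phi>(\<delta>\<xi>) \<mu>^(a\<xi>) \<mu>^(b\<xi>) \<mu>^(c\<xi>) d\<xi>\<close> with Gaussian weights vary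
  little below some scale \<open>\<delta>\<^sub>0\<close>, uniformly in \<open>\<mu>\<close>. At scale \<open>\<delta>\<^sub>0\<close> a small enough \<open>\<epsilon>\<^sub>0\<close> makes \<open>\<mu>\<close> look like a bounded
  density, so that Roth's theorem with multiplicities (Varnavides), applied to the cells of substantial mass,
  bounds \<open>\<Lambda>(\<delta>\<^sub>0)\<close>, and with it every \<open>\<Lambda>(\<delta>)\<close> with \<open>\<delta> \<le> \<delta>\<^sub>0\<close>, from below. If \<open>A\<close> had only solutions with \<open>x = y\<close>,
  inserting the character \<open>exp (i p (x - y))\<close> would not change the limit as \<open>\<delta> \<rightarrow> 0\<close>, but for large \<open>p\<close> it makes the
  integral small. Roth's theorem itself is proved by Szemeredi's argument with Hilbert cubes.
\<close>

section \<open>Sets without three-point patterns\<close>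

text \<open>The constants have to be fixed without circularity. At scale \<open>1 / J\<close> the
  ball condition bounds the mass of a cell by \<open>C * J powr \<epsilon> / J\<close>, and
  \<open>\<epsilon> = ln 2 / ln J\<close> makes \<open>J powr \<epsilon>\<close> equal to 2 whatever
  \<open>J\<close> is. So the density fed to Roth's theorem depends on C alone, and the lower bound
  for the form is known before the scale is chosen; the frequency cutoff, \<open>J\<close> and
  \<open>\<epsilon>\<close> follow in this order. The strict inequality s/2 + u > 1 gives decay of
  frequency tails. It serves twice: to compare scales, and to make the modulated form small. The
  modulation takes the place of a limit measure on the solution set, whose mass on the diagonal
  would have to be excluded. For \<open>\<gamma>\<^sub>1 = m / q\<close> and
  \<open>\<gamma>\<^sub>2 = n / q\<close> the coefficients are a = n - m, b = -n, c = m. The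
  equation eliminates k from the triple x, x - m k, x - n k, and a solution gives back t as (x - y)
  divided by \<open>\<gamma>\<^sub>1\<close>, which is nonzero exactly when x and y differ. If the
  two ratios coincide then a = 0, and two distinct points of A are all that is needed.\<close>

definition pattern_free :: "int \<Rightarrow> int \<Rightarrow> int set \<Rightarrow> bool" where
  "pattern_free m n S \<longleftrightarrow> (\<forall>x k. x \<in> S \<longrightarrow> x - m * k \<in> S \<longrightarrow> x - n * k \<in> S \<longrightarrow> k = 0)"

definition max_free :: "int \<Rightarrow> int \<Rightarrow> nat \<Rightarrow> nat" where
  "max_free m n N = Max (card ` {S. S \<subseteq> {0..<int N} \<and> pattern_free m n S})"

text \<open>By Fekete's argument this infimum is also the limit of the ratios. As an infimum it
  gives a lower bound for every N at once; the matching upper bound is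
  \<open>max_free_upper\<close>.\<close>

definition free_density :: "int \<Rightarrow> int \<Rightarrow> real" where
  "free_density m n = (INF N\<in>{1..}. real (max_free m n N) / real N)"

lemma finite_int_segment [simp]: "finite {i. p \<le> i \<and> i < (q::int) \<and> P i}"
  by (rule finite_subset[of _ "{p..<q}"]) auto

lemma pattern_free_subset: "pattern_free m n S \<Longrightarrow> T \<subseteq> S \<Longrightarrow> pattern_free m n T"
  unfolding pattern_free_def by blast

lemma pattern_free_affine:
  assumes "pattern_free m n S" "d \<noteq> 0"
  shows "pattern_free m n {i. w + d * i \<in> S}"
  unfolding pattern_free_def
proof (intro allI impI)
  fix x k
  assume *: "x \<in> {i. w + d * i \<in> S}" "x - m * k \<in> {i. w + d * i \<in> S}" "x - n * k \<in> {i. w + d * i \<in> S}"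
  have "w + d * x - m * (d * k) \<in> S" "w + d * x - n * (d * k) \<in> S" "w + d * x \<in> S"
    using * by (auto simp: algebra_simps)
  with assms have "d * k = 0" unfolding pattern_free_def by blast
  with \<open>d \<noteq> 0\<close> show "k = 0" by simp
qed

section \<open>Extremal pattern-free sets and subadditivity\<close>

lemma finite_free_sets: "finite {S. S \<subseteq> {0..<int N} \<and> pattern_free m n S}"
  by (rule finite_subset[of _ "Pow {0..<int N}"]) auto

lemma card_le_max_free:
  assumes "S \<subseteq> {0..<int N}" "pattern_free m n S"
  shows "card S \<le> max_free m n N"
  unfolding max_free_def using assms finite_free_sets by (intro Max_ge) auto

lemma max_free_attained:
  obtains S where "S \<subseteq> {0..<int N}" "pattern_free m n S" "card S = max_free m n N"
proof -
  have "max_free m n N \<in> card ` {S. S \<subseteq> {0..<int N} \<and> pattern_free m n S}"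
    unfolding max_free_def
    by (intro Max_in finite_imageI finite_free_sets)
       (auto simp: pattern_free_def intro!: exI[of _ "{}"])
  thus ?thesis using that by auto
qed

lemma max_free_le: "max_free m n N \<le> N"
proof -
  obtain S where S: "S \<subseteq> {0..<int N}" "card S = max_free m n N"
    using max_free_attained by metis
  have "card S \<le> card {0..<int N}" using S by (intro card_mono) auto
  with S show ?thesis by simp
qed

lemma card_progression_le:
  assumes "pattern_free m n S" "d \<noteq> 0"
  shows "card {i\<in>{p..<p + int N}. w + d * i \<in> S} \<le> max_free m n N"
proof -
  let ?T = "{i\<in>{0..<int N}. (w + d * p) + d * i \<in> S}"
  have "{i\<in>{p..<p + int N}. w + d * i \<in> S} = (\<lambda>i. p + i) ` ?T"
  proof (intro equalityI subsetI)
    fix i assume "i \<in> {i\<in>{p..<p + int N}. w + d * i \<in> S}"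
    hence "i - p \<in> ?T" by (auto simp: algebra_simps)
    thus "i \<in> (\<lambda>i. p + i) ` ?T" by (intro image_eqI[of _ _ "i - p"]) auto
  qed (auto simp: algebra_simps)
  hence "card {i\<in>{p..<p + int N}. w + d * i \<in> S} = card ?T"
    by (simp add: card_image)
  also have "\<dots> \<le> max_free m n N"
    by (rule card_le_max_free)
       (auto intro: pattern_free_subset[OF pattern_free_affine[OF assms, of "w + d * p"]])
  finally show ?thesis .
qed

lemma max_free_add: "max_free m n (M + N) \<le> max_free m n M + max_free m n N"
proof -
  obtain S where S: "S \<subseteq> {0..<int (M + N)}" "pattern_free m n S" "card S = max_free m n (M + N)"
    using max_free_attained by blast
  have "S \<subseteq> {i\<in>{0..<0 + int M}. 0 + 1 * i \<in> S} \<union> {i\<in>{int M..<int M + int N}. 0 + 1 * i \<in> S}"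
    using S by auto
  hence "card S \<le> card ({i\<in>{0..<0 + int M}. 0 + 1 * i \<in> S} \<union> {i\<in>{int M..<int M + int N}. 0 + 1 * i \<in> S})"
    by (intro card_mono) auto
  also have "\<dots> \<le> card {i\<in>{0..<0 + int M}. 0 + 1 * i \<in> S} + card {i\<in>{int M..<int M + int N}. 0 + 1 * i \<in> S}"
    by (rule card_Un_le)
  also have "\<dots> \<le> max_free m n M + max_free m n N"
    by (intro add_mono card_progression_le S) auto
  finally show ?thesis using S by simp
qed

lemma max_free_mult_add: "max_free m n (q * M + N) \<le> q * max_free m n M + max_free m n N"
proof (induction q)
  case (Suc q)
  have "max_free m n (Suc q * M + N) \<le> max_free m n M + max_free m n (q * M + N)"
    using max_free_add[of m n M "q * M + N"] by (simp add: algebra_simps)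
  with Suc show ?case by simp
qed simp

lemma free_density_bdd: "bdd_below ((\<lambda>N. real (max_free m n N) / real N) ` {1..})"
  by (rule bdd_belowI[of _ 0]) auto

lemma free_density_le: "free_density m n * real N \<le> real (max_free m n N)"
proof (cases "N = 0")
  case False
  have "free_density m n \<le> real (max_free m n N) / real N"
    unfolding free_density_def using False by (intro cINF_lower free_density_bdd) auto
  with False show ?thesis by (simp add: field_simps)
qed simp

lemma free_density_nonneg: "free_density m n \<ge> 0"
  unfolding free_density_def by (rule cINF_greatest) auto

lemma free_density_less:
  assumes "free_density m n < e"
  obtains N where "N \<ge> 1" "real (max_free m n N) < e * real N"
proof -
  have "\<exists>N\<in>{1..}. real (max_free m n N) / real N < e"
    using assms unfolding free_density_def by (subst (asm) cINF_less_iff[OF _ free_density_bdd]) auto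
  thus ?thesis using that by (auto simp: field_simps)
qed

lemma free_density_le_1: "free_density m n \<le> 1"
  using free_density_le[of m n 1] max_free_le[of m n 1] by linarith

text \<open>Fekete's argument: N is cut into blocks of a length M whose ratio nearly attains the
  infimum, and the remainder, shorter than M, costs at most M. The additive constant
  \<open>n0\<close> is this M.\<close>

lemma max_free_upper:
  assumes "e > 0"
  obtains n0 where "\<And>N. real (max_free m n N) \<le> (free_density m n + e) * real N + real n0"
proof -
  obtain M where M: "M \<ge> 1" "real (max_free m n M) < (free_density m n + e) * real M"
    using free_density_less[of m n "free_density m n + e"] assms by auto
  show ?thesis
  proof (rule that[of M])
    fix N
    have "max_free m n N \<le> (N div M) * max_free m n M + max_free m n (N mod M)"
      using max_free_mult_add[of m n "N div M" M "N mod M"] by simp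
    also have "max_free m n (N mod M) \<le> M"
      using max_free_le[of m n "N mod M"] mod_less_divisor[of M N] M by linarith
    finally have "real (max_free m n N) \<le> real (N div M) * real (max_free m n M) + real M"
      unfolding of_nat_mult[symmetric] of_nat_add[symmetric] by (simp only: of_nat_le_iff)
    also have "\<dots> \<le> real (N div M) * ((free_density m n + e) * real M) + real M"
      using M by (intro add_mono mult_left_mono) auto
    also have "\<dots> = (free_density m n + e) * real (N div M * M) + real M" by simp
    also have "\<dots> \<le> (free_density m n + e) * real N + real M"
      using assms free_density_nonneg[of m n]
      by (intro add_mono mult_left_mono of_nat_mono div_times_less_eq_dividend) linarith+
    finally show "real (max_free m n N) \<le> (free_density m n + e) * real N + real M" .
  qed
qed

text \<open>U splits into maximal runs of step d, and the u with u - d outside U are exactly their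
  starting points. A run is a progression, so S meets it in at most (c + e) times its length plus
  \<open>n0\<close> points: the error is \<open>n0\<close> per run. The induction removes one run at
  a time.\<close>

lemma card_runs_le:
  fixes U S :: "int set"
  assumes ub: "\<And>N. real (max_free m n N) \<le> (c + e) * real N + real n0"
    and free: "pattern_free m n S" "d \<noteq> 0" and "c + e \<ge> 0" and "finite U"
  shows "real (card (S \<inter> U)) \<le> (c + e) * real (card U) + real n0 * real (card {u\<in>U. u - d \<notin> U})"
  using \<open>finite U\<close>
proof (induction "card U" arbitrary: U rule: less_induct)
  case less
  show ?case
  proof (cases "U = {}")
    case True
    thus ?thesis by simp
  next
    case False
    \<comment> \<open>Finiteness provides a starting point: the minimum for positive d, the maximum
      for negative d.\<close>
    have "\<exists>u\<in>U. u - d \<notin> U"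
    proof (cases "d > 0")
      case True
      have "Min U - d \<notin> U" using Min_le[OF \<open>finite U\<close>, of "Min U - d"] True by auto
      thus ?thesis using False less.prems by (intro bexI[of _ "Min U"]) auto
    next
      case d: False
      have "Max U - d \<notin> U" using Max_ge[OF \<open>finite U\<close>, of "Max U - d"] d free by auto
      thus ?thesis using False less.prems by (intro bexI[of _ "Max U"]) auto
    qed
    then obtain u where u: "u \<in> U" "u - d \<notin> U" by auto
    have "\<exists>i. u + int i * d \<notin> U"
    proof (rule ccontr)
      assume "\<nexists>i. u + int i * d \<notin> U"
      hence "range (\<lambda>i. u + int i * d) \<subseteq> U" by auto
      moreover have "inj (\<lambda>i::nat. u + int i * d)" using free by (auto intro!: injI)
      ultimately show False
        using less.prems by (meson finite_subset range_inj_infinite)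
    qed
    define l where "l = (LEAST i. u + int i * d \<notin> U)"
    have l: "u + int l * d \<notin> U" unfolding l_def by (rule LeastI_ex) fact
    have l': "u + int i * d \<in> U" if "i < l" for i using not_less_Least that unfolding l_def by blast
    have "l > 0" using l u by (cases l) auto
    define R where "R = (\<lambda>i. u + int i * d) ` {..<l}"
    have RU: "R \<subseteq> U" using l' by (auto simp: R_def)
    have inj: "inj_on (\<lambda>i. u + int i * d) {..<l}" using free by (auto intro!: inj_onI)
    have cR: "card R = l" unfolding R_def using inj by (simp add: card_image)
    have fR: "finite R" by (simp add: R_def)
    have SR: "S \<inter> R = (\<lambda>i. u + d * i) ` {i\<in>{0..<0 + int l}. u + d * i \<in> S}" (is "_ = _ ` ?I")
    proof (intro equalityI subsetI)
      fix v assume "v \<in> S \<inter> R"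
      then obtain i where "i < l" "v = u + int i * d" "v \<in> S" by (auto simp: R_def)
      thus "v \<in> (\<lambda>i. u + d * i) ` ?I" by (intro image_eqI[of _ _ "int i"]) (auto simp: algebra_simps)
    next
      fix v assume "v \<in> (\<lambda>i. u + d * i) ` ?I"
      then obtain i where "i \<in> {0..<int l}" "v = u + d * i" "v \<in> S" by auto
      thus "v \<in> S \<inter> R" unfolding R_def by (auto intro!: image_eqI[of _ _ "nat i"])
    qed
    have "card (S \<inter> R) \<le> card ?I" unfolding SR by (rule card_image_le) simp
    also have "\<dots> \<le> max_free m n l" by (rule card_progression_le[OF free])
    finally have 1: "real (card (S \<inter> R)) \<le> (c + e) * real l + real n0" using ub[of l] by linarith
    have cU': "card (U - R) = card U - l" using cR RU fR by (simp add: card_Diff_subset)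
    have lU: "l \<le> card U" using cR RU less.prems card_mono by metis
    have "real (card (S \<inter> (U - R)))
        \<le> (c + e) * real (card (U - R)) + real n0 * real (card {v\<in>U - R. v - d \<notin> U - R})"
      using cU' \<open>l > 0\<close> lU less.prems by (intro less.hyps) auto
    \<comment> \<open>Removing the whole run creates no new starting point, since the only candidate
      is u + l d, which lies outside U. The start u itself disappears, which pays for the
      \<open>n0\<close> spent on the run.\<close>
    also have "card {v\<in>U - R. v - d \<notin> U - R} \<le> card ({v\<in>U. v - d \<notin> U} - {u})"
    proof (intro card_mono subsetI)
      fix v assume v: "v \<in> {v\<in>U - R. v - d \<notin> U - R}"
      have "v - d \<notin> R"
      proof
        assume "v - d \<in> R"
        then obtain i where i: "i < l" "v - d = u + int i * d" by (auto simp: R_def)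
        hence vi: "v = u + int (Suc i) * d" by (simp add: algebra_simps)
        show False
        proof (cases "Suc i < l")
          case True hence "v \<in> R" unfolding R_def vi by (intro image_eqI[of _ _ "Suc i"]) auto
          with v show False by auto
        next
          case False with i have "Suc i = l" by simp
          with vi l v show False by auto
        qed
      qed
      moreover have "u \<in> R" using \<open>l > 0\<close> by (auto simp: R_def intro!: image_eqI[of _ _ 0])
      ultimately show "v \<in> {v\<in>U. v - d \<notin> U} - {u}" using v by auto
    qed (use less.prems in auto)
    also have "card ({v\<in>U. v - d \<notin> U} - {u}) = card {v\<in>U. v - d \<notin> U} - 1"
      using u less.prems by simp
    finally have 2: "real (card (S \<inter> (U - R)))
        \<le> (c + e) * real (card (U - R)) + real n0 * real (card {v\<in>U. v - d \<notin> U} - 1)"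
      by (simp add: mult_left_mono)
    have "card {v\<in>U. v - d \<notin> U} > 0" using u less.prems by (auto simp: card_gt_0_iff)
    hence 3: "real (card {v\<in>U. v - d \<notin> U} - 1) = real (card {v\<in>U. v - d \<notin> U}) - 1" by (simp add: of_nat_diff)
    have 4: "real (card (U - R)) = real (card U) - real l" using cU' lU by (simp add: of_nat_diff)
    have "S \<inter> U = (S \<inter> R) \<union> (S \<inter> (U - R))" using RU by auto
    hence "card (S \<inter> U) \<le> card (S \<inter> R) + card (S \<inter> (U - R))" using card_Un_le[of "S \<inter> R" "S \<inter> (U - R)"] by (rule ord_eq_le_trans[OF arg_cong[where f = card]])
    hence "real (card (S \<inter> U)) \<le> real (card (S \<inter> R)) + real (card (S \<inter> (U - R)))" by linarith
    also have "\<dots> \<le> ((c + e) * real l + real n0) + ((c + e) * (real (card U) - real l) + real n0 * (real (card {v\<in>U. v - d \<notin> U}) - 1))"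
      using 1 2 unfolding 3 4 by (rule add_mono)
    also have "\<dots> = (c + e) * real (card U) + real n0 * real (card {u\<in>U. u - d \<notin> U})"
      by (simp add: algebra_simps)
    finally show ?thesis .
  qed
qed

lemma card_interval_starts_le: "card {u\<in>{p..<q::int}. u - d \<notin> {p..<q}} \<le> nat \<bar>d\<bar>"
proof (cases "d > 0")
  case True
  hence "{u\<in>{p..<q}. u - d \<notin> {p..<q}} \<subseteq> {p..<p + d}" by auto
  hence "card {u\<in>{p..<q}. u - d \<notin> {p..<q}} \<le> card {p..<p + d}" by (intro card_mono) auto
  with True show ?thesis by simp
next
  case False
  hence "{u\<in>{p..<q}. u - d \<notin> {p..<q}} \<subseteq> {q + d..<q}" by auto
  hence "card {u\<in>{p..<q}. u - d \<notin> {p..<q}} \<le> card {q + d..<q}" by (intro card_mono) auto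
  with False show ?thesis by simp
qed

text \<open>The lower bound comes from an upper bound on the complement U of the progression: S has
  total density at least c and can exceed density c on U only slightly, by
  \<open>card_runs_le\<close>. U has few runs: besides the at most |d| starts of the whole interval,
  only the point w + d q just after the progression can start one.\<close>

lemma card_progression_ge:
  assumes ub: "\<And>N. real (max_free m n N) \<le> (c + e) * real N + real n0"
    and free: "pattern_free m n S" "d \<noteq> 0" and "c \<ge> 0" "e \<ge> 0"
    and S: "S \<subseteq> {0..<int N}" "real (card S) \<ge> c * real N"
    and pq: "p \<le> q" and P: "\<And>i. i \<in> {p..<q} \<Longrightarrow> w + d * i \<in> {0..<int N}"
  shows "real (card {i\<in>{p..<q}. w + d * i \<in> S})
    \<ge> c * real_of_int (q - p) - e * real N - real n0 * (real_of_int \<bar>d\<bar> + 1)"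
proof -
  define I where "I = (\<lambda>i. w + d * i) ` {p..<q}"
  define U where "U = {0..<int N} - I"
  have inj: "inj_on (\<lambda>i. w + d * i) X" for X using free by (auto intro!: inj_onI)
  have fI: "finite I" "finite U" by (auto simp: I_def U_def)
  have cI: "card I = nat (q - p)" unfolding I_def by (simp add: card_image inj)
  have IN: "I \<subseteq> {0..<int N}" using P by (auto simp: I_def)
  have "card I \<le> card {0..<int N}" by (rule card_mono[OF _ IN]) simp
  hence "card I \<le> N" by simp
  moreover have "card U = N - card I" unfolding U_def using IN fI by (simp add: card_Diff_subset)
  ultimately have "real (card U) = real N - real (card I)" by (simp add: of_nat_diff)
  hence cU: "real (card U) = real N - real_of_int (q - p)" using cI pq by simp
  have "{u\<in>U. u - d \<notin> U} \<subseteq> insert (w + d * q) {u\<in>{0..<int N}. u - d \<notin> {0..<int N}}"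
  proof
    fix u assume u: "u \<in> {u\<in>U. u - d \<notin> U}"
    show "u \<in> insert (w + d * q) {u\<in>{0..<int N}. u - d \<notin> {0..<int N}}"
    proof (cases "u - d \<in> I")
      case True
      then obtain i where i: "i \<in> {p..<q}" "u = w + d * (i + 1)" by (auto simp: I_def algebra_simps)
      have "i + 1 \<notin> {p..<q}"
      proof
        assume "i + 1 \<in> {p..<q}"
        hence "u \<in> I" unfolding I_def i(2) by (rule imageI)
        with u show False by (simp add: U_def)
      qed
      hence "i + 1 = q" using i(1) by auto
      with i(2) show ?thesis by simp
    next
      case False
      with u show ?thesis unfolding U_def by blast
    qed
  qed
  hence "card {u\<in>U. u - d \<notin> U} \<le> card (insert (w + d * q) {u\<in>{0..<int N}. u - d \<notin> {0..<int N}})"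
    by (rule card_mono[rotated]) simp
  also have "\<dots> \<le> card {u\<in>{0..<int N}. u - d \<notin> {0..<int N}} + 1"
    by (rule card_insert_le_m1) auto
  finally have "card {u\<in>U. u - d \<notin> U} \<le> nat \<bar>d\<bar> + 1"
    using card_interval_starts_le[of 0 "int N" d] by linarith
  hence starts: "real (card {u\<in>U. u - d \<notin> U}) \<le> real_of_int \<bar>d\<bar> + 1" by linarith
  have "real (card (S \<inter> U)) \<le> (c + e) * real (card U) + real n0 * real (card {u\<in>U. u - d \<notin> U})"
    using assms fI by (intro card_runs_le) auto
  also have "\<dots> \<le> (c + e) * (real N - real_of_int (q - p)) + real n0 * (real_of_int \<bar>d\<bar> + 1)"
    unfolding cU using starts by (intro add_left_mono mult_left_mono) auto
  finally have 1: "real (card (S \<inter> U)) \<le> (c + e) * (real N - real_of_int (q - p)) + real n0 * (real_of_int \<bar>d\<bar> + 1)" .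
  have "S \<inter> I = (\<lambda>i. w + d * i) ` {i\<in>{p..<q}. w + d * i \<in> S}" by (auto simp: I_def)
  hence 2: "card (S \<inter> I) = card {i\<in>{p..<q}. w + d * i \<in> S}" by (simp only: card_image[OF inj])
  have "S = (S \<inter> I) \<union> (S \<inter> U)" using S by (auto simp: U_def)
  hence "card S \<le> card (S \<inter> I) + card (S \<inter> U)"
    using card_Un_le[of "S \<inter> I" "S \<inter> U"] by (rule ord_eq_le_trans[OF arg_cong[where f = card]])
  hence 3: "real (card S) \<le> real (card {i\<in>{p..<q}. w + d * i \<in> S}) + real (card (S \<inter> U))"
    unfolding 2 by linarith
  have 4: "e * real_of_int (q - p) \<ge> 0" using pq \<open>e \<ge> 0\<close> by simp
  have "c * real N - ((c + e) * (real N - real_of_int (q - p)) + real n0 * (real_of_int \<bar>d\<bar> + 1))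
    = c * real_of_int (q - p) - e * real N - real n0 * (real_of_int \<bar>d\<bar> + 1) + e * real_of_int (q - p)"
    by (simp add: algebra_simps)
  with 1 3 4 S(2) show ?thesis by linarith
qed

section \<open>Hilbert cubes in dense sets and Roth's theorem\<close>

lemma popular_difference:
  fixes X :: "int set"
  assumes X: "X \<subseteq> {0..<int n}" "real (card X) \<ge> a * real n" and a: "a > 0" "a * real n > 2"
  obtains x where "x \<noteq> 0" "\<bar>x\<bar> \<le> int n" "real (card {y\<in>X. y + x \<in> X}) \<ge> a\<^sup>2 / 4 * real n"
proof -
  let ?b = "a\<^sup>2 / 4 * real n"
  define D where "D = {- int n..int n} - {0}"
  define P where "P = X \<times> X - Id"
  have fX: "finite X" using X finite_subset by blast
  have "n > 0" using a by (cases n) auto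
  have Xb: "0 \<le> y \<and> y < int n" if "y \<in> X" for y using X(1) that by auto
  \<comment> \<open>Pigeonhole: there are at least a n (a n - 1) > a^2 n^2 / 2 ordered pairs of
    distinct points, because a n > 2, and only 2 n nonzero differences to share them.\<close>
  have "\<exists>x\<in>D. real (card {y\<in>X. y + x \<in> X}) \<ge> ?b"
  proof (rule ccontr)
    assume "\<not> ?thesis"
    hence *: "real (card {y\<in>X. y + x \<in> X}) \<le> ?b" if "x \<in> D" for x using that by force
    have "(\<Sum>x\<in>D. \<Sum>p\<in>{p\<in>P. snd p - fst p = x}. 1::real) = (\<Sum>p\<in>P. 1)"
      using fX Xb by (intro sum.group) (auto simp: P_def D_def dest!: Xb)
    hence "real (card P) = (\<Sum>x\<in>D. real (card {p\<in>P. snd p - fst p = x}))" by simp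
    also have "\<dots> \<le> (\<Sum>x\<in>D. ?b)"
    proof (intro sum_mono)
      fix x assume x: "x \<in> D"
      have "{p\<in>P. snd p - fst p = x} = (\<lambda>y. (y, y + x)) ` {y\<in>X. y + x \<in> X}"
        using x by (auto simp: P_def D_def)
      hence "card {p\<in>P. snd p - fst p = x} = card {y\<in>X. y + x \<in> X}"
        by (simp add: card_image inj_on_def)
      with *[OF x] show "real (card {p\<in>P. snd p - fst p = x}) \<le> ?b" by simp
    qed
    also have "\<dots> = real (card D) * ?b" by simp
    also have "card D = 2 * n" unfolding D_def by (subst card_Diff_subset) auto
    finally have 1: "real (card P) \<le> a\<^sup>2 / 2 * real n * real n" by (simp add: algebra_simps power2_eq_square)
    have "P = X \<times> X - (\<lambda>y. (y, y)) ` X" by (auto simp: P_def)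
    hence "card P = card (X \<times> X) - card ((\<lambda>y. (y, y)) ` X)"
      using fX by (simp only:) (rule card_Diff_subset, auto)
    also have "\<dots> = card X * card X - card X" using fX by (simp add: card_image inj_on_def card_cartesian_product)
    finally have 2: "real (card P) = real (card X) * (real (card X) - 1)"
      by (simp add: of_nat_diff algebra_simps)
    have "(a * real n) * (a * real n - 1) \<le> real (card X) * (real (card X) - 1)"
      using X a by (intro mult_mono) auto
    with 1 2 have 3: "(a * real n) * (a * real n - 1) \<le> a\<^sup>2 / 2 * real n * real n" by simp
    have "(a * real n) * (a * real n / 2) < (a * real n) * (a * real n - 1)"
      using a \<open>n > 0\<close> by (intro mult_strict_left_mono) auto
    with 3 show False by (simp add: power2_eq_square algebra_simps)
  qed
  then obtain x where "x \<in> D" "real (card {y\<in>X. y + x \<in> X}) \<ge> ?b" by blast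
  thus ?thesis by (intro that[of x]) (auto simp: D_def)
qed

text \<open>A Hilbert cube, given by the chain of its faces \<open>F 0 \<subseteq> \<dots> \<subseteq> F k\<close> and its differences.\<close>

definition cube_faces :: "nat \<Rightarrow> nat \<Rightarrow> (nat \<Rightarrow> int set) \<Rightarrow> (nat \<Rightarrow> int) \<Rightarrow> bool" where
  "cube_faces k n F x \<longleftrightarrow> F 0 \<noteq> {} \<and>
    (\<forall>i<k. x i \<noteq> 0 \<and> \<bar>x i\<bar> \<le> int n \<and> F (Suc i) = F i \<union> (\<lambda>v. v + x i) ` F i)"

text \<open>Induction on the dimension. For a popular difference y, the set of v with both v and v +
  y in X is still dense, with a^2 / 4 in place of a. A cube inside it, joined with its translate by
  y, is a cube of one dimension more inside X.\<close>

lemma hilbert_cube: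
  assumes "a > 0"
  shows "\<exists>n0. \<forall>n\<ge>n0. \<forall>X. X \<subseteq> {0..<int n} \<longrightarrow> real (card X) \<ge> a * real n \<longrightarrow>
    (\<exists>F x. cube_faces k n F x \<and> F k \<subseteq> X)"
  using assms
proof (induction k arbitrary: a)
  case 0
  show ?case
  proof (intro exI[of _ 1] allI impI)
    fix n :: nat and X :: "int set"
    assume "1 \<le> n" "a * real n \<le> real (card X)"
    with 0 have "card X > 0" by (smt (verit) mult_pos_pos of_nat_0_less_iff less_le_trans One_nat_def Suc_le_lessD)
    hence "X \<noteq> {}" by auto
    thus "\<exists>F x. cube_faces 0 n F x \<and> F 0 \<subseteq> X"
      by (intro exI[of _ "\<lambda>_. X"]) (auto simp: cube_faces_def)
  qed
next
  case (Suc k)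
  have "a\<^sup>2 / 4 > 0" using Suc.prems by simp
  then obtain n0 where n0: "\<forall>n\<ge>n0. \<forall>X. X \<subseteq> {0..<int n} \<longrightarrow> real (card X) \<ge> a\<^sup>2 / 4 * real n \<longrightarrow>
    (\<exists>F x. cube_faces k n F x \<and> F k \<subseteq> X)"
    using Suc.IH[of "a\<^sup>2 / 4"] by blast
  obtain n1 where n1: "real n1 > 2 / a" using reals_Archimedean2 by blast
  show ?case
  proof (intro exI[of _ "max n0 n1"] allI impI)
    fix n :: nat and X :: "int set"
    assume n: "max n0 n1 \<le> n" and X: "X \<subseteq> {0..<int n}" "a * real n \<le> real (card X)"
    have "2 / a < real n" using n n1 by linarith
    hence "a * real n > 2" using Suc.prems by (simp add: field_simps)
    then obtain y where y: "y \<noteq> 0" "\<bar>y\<bar> \<le> int n" "real (card {v\<in>X. v + y \<in> X}) \<ge> a\<^sup>2 / 4 * real n"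
      using popular_difference[OF X] Suc.prems by metis
    have Xy: "n0 \<le> n" "{v\<in>X. v + y \<in> X} \<subseteq> {0..<int n}" using X n by auto
    obtain F x where F: "cube_faces k n F x" "F k \<subseteq> {v\<in>X. v + y \<in> X}"
      using n0[rule_format, OF Xy y(3)] by blast
    show "\<exists>F x. cube_faces (Suc k) n F x \<and> F (Suc k) \<subseteq> X"
      by (intro exI[of _ "F(Suc k := F k \<union> (\<lambda>v. v + y) ` F k)"] exI[of _ "x(k := y)"])
         (use F y in \<open>auto simp: less_Suc_eq cube_faces_def\<close>)
  qed
qed

text \<open>If the density c were positive, a largest free set S would have density nearly c or more
  on every long progression with small step. For x = w + m n v and k = n v - j, the triple is w + m
  n v, w + m j, w + n (q v + j) with q = m - n. Let v run through a Hilbert cube and j through the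
  dense set A: then the sums q v + j avoid D. The sumsets E i grow along the faces of the cube, but
  not by much at every stage. Where the growth is small, E i is almost invariant under a shift, so
  its complement has few runs and carries D with density at most about c. Since E i itself occupies
  about a proportion c or more, D is thinner than the lower bound allows.\<close>

lemma free_density_eq_0:
  assumes mn: "m \<noteq> 0" "n \<noteq> 0" "m \<noteq> n"
  shows "free_density m n = 0"
proof (rule ccontr)
  define c where "c = free_density m n"
  assume "free_density m n \<noteq> 0"
  hence c: "0 < c" "c \<le> 1" using free_density_nonneg[of m n] free_density_le_1[of m n] by (auto simp: c_def)
  define q where "q = m - n"
  have "q \<noteq> 0" using mn by (simp add: q_def)
  define H where "H = \<bar>m\<bar> + \<bar>n\<bar> + \<bar>m * n\<bar>"
  have H: "\<bar>m\<bar> \<le> H" "\<bar>n\<bar> \<le> H" "\<bar>m * n\<bar> \<le> H" "H > 0"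
    unfolding H_def using mn by auto
  \<comment> \<open>The ambient length will be N = 12 H l, so that e N = c^2 l / 9, a small part of
    the main term c^2 l.\<close>
  define e where "e = c\<^sup>2 / (108 * real_of_int H)"
  have e: "e > 0" using c H by (simp add: e_def)
  obtain n0 where n0: "\<And>N. real (max_free m n N) \<le> (c + e) * real N + real n0"
    using max_free_upper[OF e, of m n] unfolding c_def by metis
  \<comment> \<open>The dimension of the cube: with |T| at most 3 l, one average growth step |T| / k
    then costs at most c^2 l / 4 when multiplied by \<open>n0\<close>.\<close>
  obtain k :: nat where k: "real k > 12 * real n0 / c\<^sup>2" using reals_Archimedean2 by blast
  have "c\<^sup>2 > 0" using c by simp
  have k0: "k > 0" by (rule ccontr) (use k c in \<open>simp add: field_simps\<close>)
  have "c / 2 > 0" using c by simp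
  then obtain n1' where n1': "\<forall>N\<ge>n1'. \<forall>X. X \<subseteq> {0..<int N} \<longrightarrow> real (card X) \<ge> c / 2 * real N \<longrightarrow>
    (\<exists>F x. cube_faces k N F x \<and> F k \<subseteq> X)"
    using hilbert_cube[of "c / 2" k] by blast
  define n1 where "n1 = max n1' 1"
  \<comment> \<open>For v in a block of length \<open>n1\<close>, Q bounds |q v|, and J exceeds n v,
    so that k = n v - j cannot vanish for j from J onwards.\<close>
  define Q where "Q = \<bar>q\<bar> * int n1"
  define J where "J = \<bar>n\<bar> * int n1 + 1"
  have QJ: "Q \<ge> 0" "J \<ge> 1" by (auto simp: Q_def J_def)
  \<comment> \<open>The number of blocks in the window of length l. It makes every run error of the
    form \<open>n0\<close> times a fixed bound at most c^2 l / 8, and the window longer than J +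
    Q.\<close>
  obtain g :: nat where g: "real g > real n0 * (2 * real_of_int H + 2 + real_of_int Q) * 8 / c\<^sup>2 + real_of_int J + real_of_int Q"
    using reals_Archimedean2 by blast
  define l where "l = n1 * g"
  have "n1 \<ge> 1" by (simp add: n1_def)
  hence "l \<ge> g" unfolding l_def by simp
  hence lg: "real l \<ge> real g" by linarith
  have pos: "real n0 * (2 * real_of_int H + 2 + real_of_int Q) * 8 / c\<^sup>2 \<ge> 0"
    using H QJ by (intro divide_nonneg_nonneg mult_nonneg_nonneg) auto
  have l1: "real_of_int J + real_of_int Q < real l"
    using g lg pos by linarith
  hence l1': "J + Q < int l" by linarith
  have "real n0 * (2 * real_of_int H + 2 + real_of_int Q) * 8 / c\<^sup>2 \<le> real l"
    using g lg pos QJ by linarith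
  hence l2: "real n0 * (2 * real_of_int H + 2 + real_of_int Q) \<le> c\<^sup>2 / 8 * real l"
    using c by (simp add: field_simps)
  define N where "N = nat (12 * H) * l"
  have NH: "int N = 12 * H * int l" using H by (simp add: N_def)
  have eN: "e * real N = c\<^sup>2 / 9 * real l"
  proof -
    have "real N = real_of_int (int N)" by simp
    also have "\<dots> = 12 * real_of_int H * real l" unfolding NH by simp
    finally show ?thesis using H by (simp add: e_def)
  qed
  obtain S where S: "S \<subseteq> {0..<int N}" "pattern_free m n S" "card S = max_free m n N"
    using max_free_attained by blast
  have Sc: "c * real N \<le> real (card S)" unfolding S c_def by (rule free_density_le)
  have lower: "real (card {i\<in>{p..<r}. w + d * i \<in> S}) \<ge> c * real_of_int (r - p) - c\<^sup>2 / 9 * real l - c\<^sup>2 / 8 * real l"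
    if "d \<noteq> 0" "\<bar>d\<bar> \<le> H" "p \<le> r" "\<And>i. i \<in> {p..<r} \<Longrightarrow> w + d * i \<in> {0..<int N}" for p r w d
  proof -
    have "real n0 * (real_of_int \<bar>d\<bar> + 1) \<le> real n0 * (2 * real_of_int H + 2 + real_of_int Q)"
      using that H QJ by (intro mult_left_mono) linarith+
    moreover have "real (card {i\<in>{p..<r}. w + d * i \<in> S}) \<ge> c * real_of_int (r - p) - e * real N - real n0 * (real_of_int \<bar>d\<bar> + 1)"
      using that S Sc c e by (intro card_progression_ge[OF n0]) auto
    ultimately show ?thesis using l2 unfolding eN by linarith
  qed
  have Hl: "\<bar>a * i\<bar> \<le> t * (H * int l)" if "\<bar>a\<bar> \<le> H" "\<bar>i\<bar> \<le> t * int l" for a i t :: int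
  proof -
    have "\<bar>a * i\<bar> \<le> H * (t * int l)" unfolding abs_mult using that H by (intro mult_mono) auto
    thus ?thesis by (simp add: mult_ac)
  qed
  \<comment> \<open>The midpoint of the ambient interval. The base w stays within H l of it, and the
    progressions used later reach at most 3 H l from w, hence never leave the interval of length 12
    H l.\<close>
  define w0 where "w0 = 6 * H * int l"
  have HL: "H * int l > 0" using H l1' QJ by simp
  \<comment> \<open>The progression of step m n carries at least (c - 17 c^2 / 72) l points of S,
    more than c l / 2 as c is at most 1; so not all blocks can have density below c / 2.\<close>
  have "\<exists>b<g. real (card {v\<in>{int b * int n1..<int b * int n1 + int n1}. w0 + m * n * v \<in> S}) \<ge> c / 2 * real n1"
  proof (rule ccontr)
    assume *: "\<not> ?thesis"
    have "{v\<in>{0..<int l}. w0 + m * n * v \<in> S}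
      \<subseteq> (\<Union>b<g. {v\<in>{int b * int n1..<int b * int n1 + int n1}. w0 + m * n * v \<in> S})"
    proof
      fix v assume v: "v \<in> {v\<in>{0..<int l}. w0 + m * n * v \<in> S}"
      have "nat v div n1 < g" using v \<open>n1 \<ge> 1\<close> unfolding l_def by (auto simp: less_mult_imp_div_less nat_less_iff mult.commute)
      moreover have "int (nat v div n1) * int n1 \<le> v" "v < int (nat v div n1) * int n1 + int n1"
      proof -
        have "nat v div n1 * n1 \<le> nat v" "nat v < nat v div n1 * n1 + n1"
          using \<open>n1 \<ge> 1\<close> dividend_less_div_times[of n1 "nat v"] by auto
        hence "int (nat v div n1 * n1) \<le> int (nat v)" "int (nat v) < int (nat v div n1 * n1 + n1)"
          unfolding of_nat_le_iff of_nat_less_iff by auto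
        thus "int (nat v div n1) * int n1 \<le> v" "v < int (nat v div n1) * int n1 + int n1"
          using v by auto
      qed
      ultimately show "v \<in> (\<Union>b<g. {v\<in>{int b * int n1..<int b * int n1 + int n1}. w0 + m * n * v \<in> S})"
        using v by auto
    qed
    hence "card {v\<in>{0..<int l}. w0 + m * n * v \<in> S}
      \<le> card (\<Union>b<g. {v\<in>{int b * int n1..<int b * int n1 + int n1}. w0 + m * n * v \<in> S})"
      by (rule card_mono[rotated]) auto
    also have "\<dots> \<le> (\<Sum>b<g. card {v\<in>{int b * int n1..<int b * int n1 + int n1}. w0 + m * n * v \<in> S})"
      by (rule card_UN_le) simp
    finally have "real (card {v\<in>{0..<int l}. w0 + m * n * v \<in> S})
      \<le> (\<Sum>b<g. real (card {v\<in>{int b * int n1..<int b * int n1 + int n1}. w0 + m * n * v \<in> S}))"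
      unfolding of_nat_sum[symmetric] by (simp only: of_nat_le_iff)
    also have "\<dots> \<le> (\<Sum>b<g. c / 2 * real n1)" using * by (intro sum_mono) force
    also have "\<dots> = c / 2 * real l" by (simp add: l_def)
    finally have 1: "real (card {v\<in>{0..<int l}. w0 + m * n * v \<in> S}) \<le> c / 2 * real l" .
    have "real (card {v\<in>{0..<int l}. w0 + m * n * v \<in> S})
      \<ge> c * real_of_int (int l - 0) - c\<^sup>2 / 9 * real l - c\<^sup>2 / 8 * real l"
    proof (rule lower)
      fix i assume "i \<in> {0..<int l}"
      hence "\<bar>m * n * i\<bar> \<le> 1 * (H * int l)" using H by (intro Hl) auto
      thus "w0 + m * n * i \<in> {0..<int N}" unfolding w0_def NH using HL by auto
    qed (use mn H in auto)
    moreover have "c\<^sup>2 * real l \<le> c * real l"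
      using c by (intro mult_right_mono) (auto simp: power2_eq_square mult_le_cancel_left1)
    moreover have "c * real l > 0" using c l1' QJ by simp
    ultimately show False using 1 by (simp add: mult.commute)
  qed
  then obtain b where b: "b < g"
    "real (card {v\<in>{int b * int n1..<int b * int n1 + int n1}. w0 + m * n * v \<in> S}) \<ge> c / 2 * real n1" by blast
  define w where "w = w0 + m * n * (int b * int n1)"
  have w: "\<bar>w - w0\<bar> \<le> H * int l"
  proof -
    have "int b * int n1 \<le> int g * int n1" using b by (intro mult_right_mono) auto
    hence "\<bar>m * n * (int b * int n1)\<bar> \<le> 1 * (H * int l)"
      using H by (intro Hl) (auto simp: l_def mult.commute)
    thus ?thesis by (simp add: w_def)
  qed
  have wS: "w + d * i \<in> {0..<int N}" if "\<bar>d\<bar> \<le> H" "\<bar>i\<bar> \<le> 3 * int l" for d i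
    using Hl[OF that] w HL unfolding w0_def NH by auto
  define V where "V = {v\<in>{0..<int n1}. w + m * n * v \<in> S}"
  have "{v\<in>{int b * int n1..<int b * int n1 + int n1}. w0 + m * n * v \<in> S} = (\<lambda>v. v + int b * int n1) ` V"
  proof (intro equalityI subsetI)
    fix v assume v: "v \<in> {v\<in>{int b * int n1..<int b * int n1 + int n1}. w0 + m * n * v \<in> S}"
    hence "v - int b * int n1 \<in> V" unfolding V_def w_def by (auto simp: algebra_simps)
    thus "v \<in> (\<lambda>v. v + int b * int n1) ` V" by (intro image_eqI[of _ _ "v - int b * int n1"]) auto
  qed (auto simp: V_def w_def algebra_simps)
  with b(2) have Vc: "c / 2 * real n1 \<le> real (card V)" by (simp add: card_image)
  have V0: "V \<subseteq> {0..<int n1}" "n1' \<le> n1" by (auto simp: V_def n1_def)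
  obtain F x where cube: "cube_faces k n1 F x" and FV: "F k \<subseteq> V"
    using n1'[rule_format, OF V0(2) V0(1) Vc] by blast
  have F: "F 0 \<noteq> {}" "\<And>i. i < k \<Longrightarrow> x i \<noteq> 0" "\<And>i. i < k \<Longrightarrow> \<bar>x i\<bar> \<le> int n1"
      "\<And>i. i < k \<Longrightarrow> F (Suc i) = F i \<union> (\<lambda>v. v + x i) ` F i"
    using cube unfolding cube_faces_def by blast+
  have FS: "F i \<subseteq> F (Suc i)" if "i < k" for i using F(4)[OF that] by blast
  have F0: "F 0 \<subseteq> F i" if "i \<le> k" for i
    using that
  proof (induction i)
    case (Suc i)
    thus ?case using FS[of i] by fastforce
  qed simp
  have Fk: "F i \<subseteq> V" if "i \<le> k" for i
  proof -
    have "F i \<subseteq> F k" using that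
    proof (induction rule: inc_induct)
      case (step i)
      thus ?case using FS[of i] by fastforce
    qed simp
    with FV show ?thesis by simp
  qed
  define A where "A = {j\<in>{J..<J + int l}. w + m * j \<in> S}"
  define D where "D = {i. w + n * i \<in> S}"
  \<comment> \<open>The window of indices j is widened by Q on both sides so that it contains every
    sum q v + j.\<close>
  define T where "T = {J - Q..<J + int l + Q}"
  define E where "E i = (\<lambda>(v, j). q * v + j) ` (F i \<times> A)" for i
  have Ac: "real (card A) \<ge> c * real l - c\<^sup>2 / 9 * real l - c\<^sup>2 / 8 * real l"
  proof -
    have "real (card {j\<in>{J..<J + int l}. w + m * j \<in> S})
      \<ge> c * real_of_int (J + int l - J) - c\<^sup>2 / 9 * real l - c\<^sup>2 / 8 * real l"
    proof (rule lower)
      fix j assume "j \<in> {J..<J + int l}"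
      hence "\<bar>j\<bar> \<le> 3 * int l" using QJ l1' by auto
      thus "w + m * j \<in> {0..<int N}" using H by (intro wS)
    qed (use mn H QJ in auto)
    thus ?thesis by (simp add: A_def)
  qed
  have Dc: "real (card (D \<inter> T)) \<ge> c * (real l + 2 * real_of_int Q) - c\<^sup>2 / 9 * real l - c\<^sup>2 / 8 * real l"
  proof -
    have "real (card {j\<in>{J - Q..<J + int l + Q}. w + n * j \<in> S})
      \<ge> c * real_of_int (J + int l + Q - (J - Q)) - c\<^sup>2 / 9 * real l - c\<^sup>2 / 8 * real l"
    proof (rule lower)
      fix j assume "j \<in> {J - Q..<J + int l + Q}"
      hence "\<bar>j\<bar> \<le> 3 * int l" using QJ l1' by auto
      thus "w + n * j \<in> {0..<int N}" using H by (intro wS)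
    qed (use mn H QJ in auto)
    moreover have "{j\<in>{J - Q..<J + int l + Q}. w + n * j \<in> S} = D \<inter> T" by (auto simp: D_def T_def)
    ultimately show ?thesis by (simp add: algebra_simps)
  qed
  have cT: "card T = l + 2 * nat Q" unfolding T_def using QJ by auto
  hence cT': "real (card T) = real l + 2 * real_of_int Q" using QJ by simp
  have Vq: "\<bar>q * v\<bar> \<le> Q" "n * v < J" if "v \<in> V" for v
  proof -
    have v: "0 \<le> v" "v \<le> int n1" using that by (auto simp: V_def)
    show "\<bar>q * v\<bar> \<le> Q" unfolding Q_def abs_mult using v by (intro mult_left_mono) auto
    have "n * v \<le> \<bar>n\<bar> * int n1" using v by (intro mult_mono) auto
    thus "n * v < J" by (simp add: J_def)
  qed
  have ET: "E i \<subseteq> T" if ik: "i \<le> k" for i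
  proof
    fix z assume "z \<in> E i"
    then obtain v j where vj: "v \<in> F i" "j \<in> A" "z = q * v + j" unfolding E_def by fast
    have "\<bar>q * v\<bar> \<le> Q" using Vq(1) Fk[OF ik] vj(1) by blast
    moreover have "J \<le> j" "j < J + int l" using vj(2) unfolding A_def by simp_all
    ultimately show "z \<in> T" unfolding T_def vj(3) atLeastLessThan_iff by linarith
  qed
  \<comment> \<open>A common point would complete a pattern with k = n v - j; then k = 0,
    contradicting n v < J \<le> j.\<close>
  have ED: "E i \<inter> D = {}" if ik: "i \<le> k" for i
  proof -
    have False if "v \<in> V" "j \<in> A" "q * v + j \<in> D" for v j
    proof -
      have eq: "w + m * n * v - m * (n * v - j) = w + m * j" "w + m * n * v - n * (n * v - j) = w + n * (q * v + j)"
        unfolding q_def by algebra+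
      have "w + m * n * v \<in> S" "w + m * n * v - m * (n * v - j) \<in> S" "w + m * n * v - n * (n * v - j) \<in> S"
        unfolding eq using that unfolding V_def A_def D_def by blast+
      hence "n * v - j = 0"
        by (rule S(2)[unfolded pattern_free_def, rule_format, of "w + m * n * v" "n * v - j"])
      moreover have "n * v < J" "J \<le> j" using Vq(2) that unfolding A_def by simp_all
      ultimately show False by linarith
    qed
    with Fk[OF ik] show ?thesis unfolding E_def by fast
  qed
  have ESuc: "E (Suc i) = E i \<union> (\<lambda>z. z + q * x i) ` E i" if "i < k" for i
  proof -
    have "E (Suc i) = E i \<union> (\<lambda>(v, j). q * v + j) ` ((\<lambda>(v, j). (v + x i, j)) ` (F i \<times> A))"
      unfolding E_def F(4)[OF that] image_Un[symmetric] by (rule arg_cong[where f = "image _"]) auto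
    also have "(\<lambda>(v, j). q * v + j) ` ((\<lambda>(v, j). (v + x i, j)) ` (F i \<times> A)) = (\<lambda>z. z + q * x i) ` E i"
      unfolding E_def image_image by (intro image_cong) (auto simp: algebra_simps)
    finally show ?thesis .
  qed
  have fT: "finite T" by (simp add: T_def)
  have fE: "finite (E i)" if ik: "i \<le> k" for i using ET[OF ik] fT finite_subset by blast
  have EA: "card A \<le> card (E i)" if ik: "i \<le> k" for i
  proof -
    obtain v where "v \<in> F i" using F(1) F0[OF ik] by blast
    hence "(\<lambda>j. q * v + j) ` A \<subseteq> E i" by (auto simp: E_def)
    hence "card ((\<lambda>j. q * v + j) ` A) \<le> card (E i)" using fE[OF ik] by (rule card_mono[rotated])
    thus ?thesis by (simp add: card_image)
  qed
  \<comment> \<open>The sizes of the E i telescope to at most |T| over k stages, so some stage is no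
    larger than the average.\<close>
  have "\<exists>i<k. real (card (E (Suc i))) - real (card (E i)) \<le> real (card T) / real k"
  proof (rule ccontr)
    assume "\<not> ?thesis"
    hence "(\<Sum>i<k. real (card T) / real k) < (\<Sum>i<k. real (card (E (Suc i))) - real (card (E i)))"
      using k0 by (intro sum_strict_mono) auto
    also have "\<dots> = real (card (E k)) - real (card (E 0))" by (rule sum_lessThan_telescope)
    also have "\<dots> \<le> real (card T)" using card_mono[OF fT ET[of k]] by simp
    finally show False using k0 by simp
  qed
  then obtain i where i: "i < k" "real (card (E (Suc i))) - real (card (E i)) \<le> real (card T) / real k" by blast
  define d where "d = q * x i"
  have d: "d \<noteq> 0" "\<bar>d\<bar> \<le> Q"
    using F(2,3)[OF i(1)] \<open>q \<noteq> 0\<close> unfolding d_def Q_def abs_mult by (auto intro: mult_left_mono)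
  define U where "U = T - E i"
  have Ei: "E i \<subseteq> T" "finite (E i)" using ET fE i by auto
  have "E i \<subseteq> E (Suc i)" using ESuc[OF i(1)] by auto
  hence "card (E (Suc i) - E i) = card (E (Suc i)) - card (E i)" "card (E i) \<le> card (E (Suc i))"
    using Ei fE[of "Suc i"] i by (auto simp: card_Diff_subset intro: card_mono)
  hence newc: "real (card (E (Suc i) - E i)) \<le> real (card T) / real k" using i by (simp add: of_nat_diff)
  \<comment> \<open>A run of T - E i starts either where T does or just after a point of E i. In the
    second case the start belongs to the shifted copy of E i, so it is one of the few points new in
    E (i + 1).\<close>
  have "{u\<in>U. u - d \<notin> U} \<subseteq> {u\<in>T. u - d \<notin> T} \<union> (E (Suc i) - E i)"
  proof
    fix u assume u: "u \<in> {u\<in>U. u - d \<notin> U}"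
    have "u \<in> E (Suc i)" if "u - d \<in> E i"
      unfolding ESuc[OF i(1)] d_def[symmetric] using that by (intro UnI2 image_eqI[of _ _ "u - d"]) auto
    with u show "u \<in> {u\<in>T. u - d \<notin> T} \<union> (E (Suc i) - E i)" unfolding U_def by blast
  qed
  hence "card {u\<in>U. u - d \<notin> U} \<le> card ({u\<in>T. u - d \<notin> T} \<union> (E (Suc i) - E i))"
    using fT fE[of "Suc i"] i by (intro card_mono) auto
  also have "\<dots> \<le> card {u\<in>T. u - d \<notin> T} + card (E (Suc i) - E i)" by (rule card_Un_le)
  also have "card {u\<in>T. u - d \<notin> T} \<le> nat \<bar>d\<bar>" unfolding T_def by (rule card_interval_starts_le)
  finally have "real (card {u\<in>U. u - d \<notin> U}) \<le> real (nat \<bar>d\<bar>) + real (card (E (Suc i) - E i))"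
    by linarith
  hence starts: "real (card {u\<in>U. u - d \<notin> U}) \<le> real_of_int Q + real (card T) / real k"
    using newc d by linarith
  have DTU: "D \<inter> T = D \<inter> U" using ED[of i] i unfolding U_def by auto
  have "pattern_free m n D" unfolding D_def using S mn by (intro pattern_free_affine)
  hence "real (card (D \<inter> T)) \<le> (c + e) * real (card U) + real n0 * real (card {u\<in>U. u - d \<notin> U})"
    unfolding DTU by (rule card_runs_le[OF n0 _ d(1)]) (use c e fT in \<open>auto simp: U_def\<close>)
  also have "\<dots> \<le> (c + e) * real (card U) + real n0 * (real_of_int Q + real (card T) / real k)"
    using starts by (intro add_left_mono mult_left_mono) auto
  also have "real (card U) = real (card T) - real (card (E i))"
    unfolding U_def using Ei card_mono[OF fT Ei(1)] by (simp add: card_Diff_subset of_nat_diff)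
  finally have main: "real (card (D \<inter> T))
     \<le> (c + e) * (real (card T) - real (card (E i))) + real n0 * (real_of_int Q + real (card T) / real k)" .
  have Tl: "real (card T) \<le> 3 * real l" using cT' l1 QJ by linarith
  have t1: "e * real (card T) \<le> c\<^sup>2 / 36 * real l"
  proof -
    have "real_of_int H \<ge> 1" using H(4) by linarith
    hence "108 \<le> 108 * real_of_int H" "0 < 108 * real_of_int H * 108" by linarith+
    hence e108: "e \<le> c\<^sup>2 / 108" unfolding e_def by (intro divide_left_mono) auto
    have "e * real (card T) \<le> c\<^sup>2 / 108 * (3 * real l)" by (rule mult_mono[OF e108 Tl]) auto
    also have "\<dots> = c\<^sup>2 / 36 * real l" by simp
    finally show ?thesis .
  qed
  have t2: "real n0 * real_of_int Q \<le> c\<^sup>2 / 8 * real l"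
  proof -
    have "real n0 * real_of_int Q \<le> real n0 * (2 * real_of_int H + 2 + real_of_int Q)"
      using H by (intro mult_left_mono) auto
    with l2 show ?thesis by linarith
  qed
  have t3: "real n0 * (real (card T) / real k) \<le> c\<^sup>2 / 4 * real l"
  proof -
    have "real n0 / real k \<le> c\<^sup>2 / 12" using k k0 c by (simp add: field_simps)
    hence "real n0 / real k * real (card T) \<le> c\<^sup>2 / 12 * (3 * real l)" using Tl by (rule mult_mono) auto
    thus ?thesis by (simp add: mult.commute)
  qed
  have t4: "c * (c * real l - c\<^sup>2 / 9 * real l - c\<^sup>2 / 8 * real l) \<le> (c + e) * real (card (E i))"
  proof -
    have "c * (c * real l - c\<^sup>2 / 9 * real l - c\<^sup>2 / 8 * real l) \<le> c * real (card (E i))"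
      using Ac EA[of i] i c by (intro mult_left_mono) auto
    also have "\<dots> \<le> (c + e) * real (card (E i))" using e by (intro mult_right_mono) auto
    finally show ?thesis .
  qed
  have t5: "c * (c\<^sup>2 * real l) \<le> c\<^sup>2 * real l"
    using c mult_right_mono[of c 1 "c\<^sup>2 * real l"] by simp
  have t6: "c\<^sup>2 * real l > 0" using c l1 QJ by simp
  have "c * real (card T) - c\<^sup>2 / 9 * real l - c\<^sup>2 / 8 * real l
    \<le> c * real (card T) + e * real (card T) - (c + e) * real (card (E i))
      + real n0 * real_of_int Q + real n0 * (real (card T) / real k)"
    using main Dc unfolding cT' by (simp add: algebra_simps)
  \<comment> \<open>The errors add up to 46/72 of c^2 l, whereas the left side is at least 55/72 of
    it because c \<le> 1.\<close>
  hence "c * (c * real l - c\<^sup>2 / 9 * real l - c\<^sup>2 / 8 * real l)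
    \<le> c\<^sup>2 / 9 * real l + c\<^sup>2 / 8 * real l + c\<^sup>2 / 36 * real l + c\<^sup>2 / 8 * real l + c\<^sup>2 / 4 * real l"
    using t1 t2 t3 t4 by linarith
  moreover have "c * (c * real l - c\<^sup>2 / 9 * real l - c\<^sup>2 / 8 * real l)
    = c\<^sup>2 * real l - 17 / 72 * (c * (c\<^sup>2 * real l))" by (simp add: algebra_simps power2_eq_square)
  ultimately show False using t5 t6 by linarith
qed

section \<open>Roth's theorem with multiplicities\<close>

definition patterns :: "int \<Rightarrow> int \<Rightarrow> int set \<Rightarrow> (int \<times> int) set" where
  "patterns m n S = {(x, k). k \<noteq> 0 \<and> x \<in> S \<and> x - m * k \<in> S \<and> x - n * k \<in> S}"

lemma pattern_step_bound:
  assumes "m \<noteq> 0" "x \<in> {0..<int N}" "x - m * k \<in> {0..<int N}"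
  shows "\<bar>k\<bar> \<le> int N"
proof -
  have "1 * \<bar>k\<bar> \<le> \<bar>m\<bar> * \<bar>k\<bar>" using assms(1) by (intro mult_right_mono) auto
  hence "\<bar>k\<bar> \<le> \<bar>m * k\<bar>" by (simp add: abs_mult)
  thus ?thesis using assms by auto
qed

lemma patterns_subset:
  assumes "m \<noteq> 0" "S \<subseteq> {0..<int N}"
  shows "patterns m n S \<subseteq> {0..<int N} \<times> {-int N..int N}"
proof
  fix p assume "p \<in> patterns m n S"
  then obtain x k where p: "p = (x, k)" "x \<in> S" "x - m * k \<in> S" by (auto simp: patterns_def)
  hence "x \<in> {0..<int N}" "x - m * k \<in> {0..<int N}" using assms by blast+
  with pattern_step_bound[OF assms(1)] show "p \<in> {0..<int N} \<times> {-int N..int N}"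
    unfolding p by fastforce
qed

text \<open>Double counting of the points of S on the translates. Since y ranges over [-N, N) and d
  L \<le> N, each index i sees the whole of S, so the total is L times the size of S. Translates
  without a pattern hold at most a L / 4 points each, together at most half of that total; the
  others hold at most L points each.\<close>

lemma many_translates_with_pattern:
  assumes L: "real (max_free m n L) < a / 4 * real L" "L \<ge> 1" "a > 0"
    and S: "S \<subseteq> {0..<int N}" "real (card S) \<ge> a * real N"
    and d: "d > 0" "d * int L \<le> int N"
  shows "real (card {y\<in>{-int N..<int N}. \<not> pattern_free m n {i\<in>{0..<int L}. y + d * i \<in> S}}) \<ge> a / 2 * real N"
proof -
  define T where "T y = {i\<in>{0..<int L}. y + d * i \<in> S}" for y
  define Y where "Y = {-int N..<int N}"
  define G where "G = {y\<in>Y. \<not> pattern_free m n (T y)}"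
  have T: "card (T y) \<le> L" for y
  proof -
    have "card (T y) \<le> card {0..<int L}" unfolding T_def by (rule card_mono) auto
    thus ?thesis by simp
  qed
  have "real L * real (card S) = (\<Sum>i\<in>{0..<int L}. \<Sum>y\<in>Y. if y + d * i \<in> S then 1 else 0)"
  proof -
    have "(\<Sum>y\<in>Y. if y + d * i \<in> S then 1 else 0) = real (card S)" if i: "i \<in> {0..<int L}" for i
    proof -
      have di: "0 \<le> d * i" "d * i \<le> int N"
      proof -
        have "d * i \<le> d * int L" using i d by (intro mult_left_mono) auto
        thus "d * i \<le> int N" using d by linarith
      qed (use i d in auto)
      have "(\<Sum>y\<in>Y. if y + d * i \<in> S then 1 else 0) = real (card {y\<in>Y. y + d * i \<in> S})"
        by (simp add: Y_def flip: sum.inter_filter)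
      also have "{y\<in>Y. y + d * i \<in> S} = (\<lambda>s. s - d * i) ` S"
      proof (intro equalityI subsetI)
        fix y assume "y \<in> {y\<in>Y. y + d * i \<in> S}"
        thus "y \<in> (\<lambda>s. s - d * i) ` S" by (intro image_eqI[of _ _ "y + d * i"]) auto
      next
        fix y assume "y \<in> (\<lambda>s. s - d * i) ` S"
        then obtain s where "s \<in> S" "y = s - d * i" by blast
        moreover have "0 \<le> s" "s < int N" using S(1) \<open>s \<in> S\<close> by auto
        ultimately show "y \<in> {y\<in>Y. y + d * i \<in> S}" using di unfolding Y_def by simp
      qed
      finally show ?thesis by (simp add: card_image)
    qed
    thus ?thesis by simp
  qed
  also have "\<dots> = (\<Sum>y\<in>Y. \<Sum>i\<in>{0..<int L}. if y + d * i \<in> S then 1 else 0)" by (rule sum.swap)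
  also have "\<dots> = (\<Sum>y\<in>Y. real (card (T y)))"
    by (intro sum.cong refl) (simp add: T_def flip: sum.inter_filter)
  also have "\<dots> \<le> (\<Sum>y\<in>Y. real L * (if y \<in> G then 1 else 0) + a / 4 * real L)"
  proof (intro sum_mono)
    fix y assume y: "y \<in> Y"
    show "real (card (T y)) \<le> real L * (if y \<in> G then 1 else 0) + a / 4 * real L"
    proof (cases "y \<in> G")
      case True
      moreover have "a / 4 * real L \<ge> 0" "real (card (T y)) \<le> real L" using T[of y] \<open>a > 0\<close> by auto
      ultimately show ?thesis by simp
    next
      case False
      hence "card (T y) \<le> max_free m n L"
        using y unfolding G_def by (intro card_le_max_free) (auto simp: T_def)
      thus ?thesis using False L by simp
    qed
  qed
  also have "\<dots> = real L * (\<Sum>y\<in>Y. if y \<in> G then 1 else 0) + real (card Y) * (a / 4 * real L)"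
    by (simp add: sum.distrib sum_distrib_left)
  also have "(\<Sum>y\<in>Y. if y \<in> G then 1 else 0) = real (card {y\<in>Y. y \<in> G})"
    by (simp add: Y_def flip: sum.inter_filter)
  also have "{y\<in>Y. y \<in> G} = G" unfolding G_def by blast
  also have "card Y = 2 * N" unfolding Y_def by simp
  finally have "real L * real (card S) \<le> real L * (real (card G) + a / 2 * real N)"
    by (simp add: algebra_simps)
  hence "real (card S) \<le> real (card G) + a / 2 * real N" using L by (simp add: mult_le_cancel_left)
  hence "a / 2 * real N \<le> real (card G)" using S by (simp add: field_simps)
  thus ?thesis unfolding G_def T_def Y_def .
qed

text \<open>Varnavides' averaging argument: count pairs \<open>(d, y)\<close> such that the progression
  \<open>y, y + d, \<dots>, y + (L - 1) d\<close> contains a pattern of \<open>S\<close>.\<close>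

lemma many_patterns:
  assumes mn: "m \<noteq> 0" "n \<noteq> 0" "m \<noteq> n" and a: "a > 0"
  obtains c N0 where "c > 0"
    "\<And>N S. N \<ge> N0 \<Longrightarrow> S \<subseteq> {0..<int N} \<Longrightarrow> real (card S) \<ge> a * real N \<Longrightarrow>
      real (card (patterns m n S)) \<ge> c * (real N)\<^sup>2"
proof -
  obtain L where L: "L \<ge> 1" "real (max_free m n L) < a / 4 * real L"
    using free_density_less[of m n "a / 4"] free_density_eq_0[OF mn] a by auto
  \<comment> \<open>There are at least N / (2 L) steps d, each with a N / 2 good translates, and
    each pattern is paired with L (2 L + 1) positions (i, j).\<close>
  define c where "c = a / (4 * real L * (real L * (2 * real L + 1)))"
  have c: "c > 0" using a L by (simp add: c_def)
  show ?thesis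
  proof (rule that[OF c, of "2 * L"])
    fix N S
    assume N: "2 * L \<le> N" and S: "S \<subseteq> {0..<int N}" "real (card S) \<ge> a * real N"
    define D where "D = N div L"
    define G where "G d = {y\<in>{-int N..<int N}. \<not> pattern_free m n {i\<in>{0..<int L}. y + d * i \<in> S}}" for d
    define P where "P = patterns m n S \<times> ({0..<int L} \<times> {-int L..int L})"
    \<comment> \<open>Recovers the step and the base (d, y) from the pattern (y + d i, d j) and the
      position (i, j); the division is exact as j is nonzero.\<close>
    define f :: "(int \<times> int) \<times> (int \<times> int) \<Rightarrow> int \<times> int"
      where "f = (\<lambda>((x, k), (i, j)). (k div j, x - (k div j) * i))"
    have finp: "finite (patterns m n S)" by (rule finite_subset[OF patterns_subset[OF mn(1) S(1)]]) simp
    have Gd: "real (card (G d)) \<ge> a / 2 * real N" if "d \<in> {1..int D}" for d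
    proof -
      have "d * int L \<le> int D * int L" using that by (intro mult_right_mono) auto
      also have "\<dots> = int (D * L)" by simp
      also have "\<dots> \<le> int N" unfolding D_def of_nat_le_iff by simp
      finally show ?thesis unfolding G_def using that
        by (intro many_translates_with_pattern L a S) auto
    qed
    have "Sigma {1..int D} G \<subseteq> f ` P"
    proof
      fix p assume "p \<in> Sigma {1..int D} G"
      then obtain d y where p: "p = (d, y)" "d \<in> {1..int D}" "y \<in> G d" by blast
      then obtain i j where ij: "i \<in> {0..<int L}" "y + d * i \<in> S" "i - m * j \<in> {0..<int L}" "y + d * (i - m * j) \<in> S"
        "y + d * (i - n * j) \<in> S" "j \<noteq> 0"
        unfolding G_def pattern_free_def by blast
      have j: "j \<in> {-int L..int L}" using pattern_step_bound[OF mn(1) ij(1,3)] by auto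
      have "(y + d * i, d * j) \<in> patterns m n S"
        using ij p(2) unfolding patterns_def by (auto simp: algebra_simps)
      with j ij(1) have "((y + d * i, d * j), (i, j)) \<in> P" by (simp add: P_def)
      moreover have "p = f ((y + d * i, d * j), (i, j))" using ij(6) by (simp add: f_def p)
      ultimately show "p \<in> f ` P" by blast
    qed
    moreover have "finite P" using finp by (simp add: P_def)
    ultimately have "card (Sigma {1..int D} G) \<le> card P"
      by (rule surj_card_le[rotated])
    hence "real (card (Sigma {1..int D} G)) \<le> real (card P)" by (simp only: of_nat_le_iff)
    moreover have "card (Sigma {1..int D} G) = (\<Sum>d\<in>{1..int D}. card (G d))"
      by (rule card_SigmaI) (auto simp: G_def)
    moreover have "(\<Sum>d\<in>{1..int D}. a / 2 * real N) \<le> (\<Sum>d\<in>{1..int D}. real (card (G d)))"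
      by (intro sum_mono Gd)
    ultimately have 1: "real D * (a / 2 * real N) \<le> real (card P)" by simp
    have "card P = card (patterns m n S) * (L * (2 * L + 1))"
    proof -
      have "card {-int L..int L} = 2 * L + 1" by simp
      thus ?thesis unfolding P_def by (simp only: card_cartesian_product card_atLeastLessThan_int) simp
    qed
    with 1 have 2: "real D * (a / 2 * real N) \<le> real (card (patterns m n S)) * (real L * (2 * real L + 1))"
      by (simp add: algebra_simps)
    have "N < D * L + L" unfolding D_def using dividend_less_div_times[of L N] L by simp
    with N have "N \<le> 2 * (D * L)" by linarith
    hence "real N \<le> real (2 * (D * L))" by (simp only: of_nat_le_iff)
    hence "real N / (2 * real L) \<le> real D" using L by (simp add: field_simps)
    hence "real N / (2 * real L) * (a / 2 * real N) \<le> real D * (a / 2 * real N)"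
      using a by (intro mult_right_mono) auto
    with 2 have "real N / (2 * real L) * (a / 2 * real N) \<le> real (card (patterns m n S)) * (real L * (2 * real L + 1))"
      by linarith
    moreover have "c * (real N)\<^sup>2 * (real L * (2 * real L + 1)) = real N / (2 * real L) * (a / 2 * real N)"
    proof -
      have "real L * (2 * real L + 1) \<noteq> 0" "real L \<noteq> 0" using L by auto
      thus ?thesis unfolding c_def by (simp add: power2_eq_square)
    qed
    moreover have "real L * (2 * real L + 1) > 0" using L by simp
    ultimately show "c * (real N)\<^sup>2 \<le> real (card (patterns m n S))"
      by (metis mult_le_cancel_right_pos)
  qed
qed

section \<open>Smoothed trilinear forms and characteristic functions\<close>

text \<open>This is sqrt (2 pi) times the normal density of deviation \<delta>; with this factor it
  is exactly the Fourier integral of \<open>std_normal_density (\<delta> * \<xi>)\<close>.\<close>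

definition gauss_kernel :: "real \<Rightarrow> real \<Rightarrow> real" where
  "gauss_kernel \<delta> v = exp (- (v / \<delta>)\<^sup>2 / 2) / \<delta>"

lemma gauss_fourier:
  assumes "\<delta> > 0"
  shows "(CLBINT \<xi>. complex_of_real (std_normal_density (\<delta> * \<xi>)) * iexp (\<xi> * v)) = complex_of_real (gauss_kernel \<delta> v)"
proof -
  have "(CLBINT x. complex_of_real (std_normal_density x) * iexp (v / \<delta> * x)) = char std_normal_distribution (v / \<delta>)"
    unfolding char_def by (subst integral_density) (auto simp: scaleR_conv_of_real normal_density_nonneg)
  also have "\<dots> = complex_of_real (exp (- (v / \<delta>)\<^sup>2 / 2))"
    by (simp add: char_std_normal_distribution)
  finally have "complex_of_real (exp (- (v / \<delta>)\<^sup>2 / 2))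
      = (CLBINT x. complex_of_real (std_normal_density x) * iexp (v / \<delta> * x))" by simp
  also have "\<dots> = \<delta> *\<^sub>R (CLBINT \<xi>. complex_of_real (std_normal_density (0 + \<delta> * \<xi>)) * iexp (v / \<delta> * (0 + \<delta> * \<xi>)))"
    using assms by (subst lborel_integral_real_affine[of \<delta> _ 0]) auto
  also have "(\<lambda>\<xi>. complex_of_real (std_normal_density (0 + \<delta> * \<xi>)) * iexp (v / \<delta> * (0 + \<delta> * \<xi>)))
    = (\<lambda>\<xi>. complex_of_real (std_normal_density (\<delta> * \<xi>)) * iexp (\<xi> * v))"
    using assms by (intro ext) (simp add: field_simps)
  finally show ?thesis using assms by (simp add: gauss_kernel_def scaleR_conv_of_real field_simps)
qed

lemma integrable_std_normal_scaled:
  assumes "\<delta> > 0"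
  shows "integrable lborel (\<lambda>\<xi>. std_normal_density (\<delta> * \<xi>))"
proof -
  have "integrable lborel std_normal_density" by (rule integrable_normal_density) simp
  from lborel_integrable_real_affine[OF this, of \<delta> 0] assms show ?thesis by simp
qed

lemma integral_pair_mult:
  fixes f :: "'a \<Rightarrow> complex" and g :: "'b \<Rightarrow> complex"
  assumes "sigma_finite_measure M" "sigma_finite_measure N" "integrable M f" "integrable N g"
  shows "(\<integral>p. f (fst p) * g (snd p) \<partial>(M \<Otimes>\<^sub>M N)) = (\<integral>x. f x \<partial>M) * (\<integral>y. g y \<partial>N)"
proof -
  interpret M: sigma_finite_measure M by fact
  interpret N: sigma_finite_measure N by fact
  interpret pair_sigma_finite M N ..
  note [measurable] = borel_measurable_integrable[OF assms(3)] borel_measurable_integrable[OF assms(4)]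
  have "integrable (M \<Otimes>\<^sub>M N) (\<lambda>p. f (fst p) * g (snd p))"
    by (rule Fubini_integrable) (use assms in \<open>auto simp: norm_mult intro!: integrable_mult_left\<close>)
  from integral_fst'[OF this] show ?thesis by simp
qed

section \<open>Three independent copies and their characteristic functions\<close>

context real_distribution
begin

definition triple :: "(real \<times> real \<times> real) measure" where
  "triple = M \<Otimes>\<^sub>M (M \<Otimes>\<^sub>M M)"

lemma sets_triple: "sets triple = sets (borel \<Otimes>\<^sub>M (borel \<Otimes>\<^sub>M borel))"
  unfolding triple_def by (intro sets_pair_measure_cong) auto

lemma space_triple [simp]: "space triple = UNIV"
  by (simp add: triple_def space_pair_measure)

lemma prob_triple: "prob_space triple"
proof -
  interpret P: pair_prob_space M M ..
  interpret Q: pair_prob_space M "M \<Otimes>\<^sub>M M" ..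
  show ?thesis unfolding triple_def by unfold_locales
qed

lemma char_prod:
  "char M s * char M t * char M r = (\<integral>(x, y, z). iexp (s * x + t * y + r * z) \<partial>triple)"
proof -
  interpret P: pair_prob_space M M ..
  have int: "integrable M (\<lambda>x. iexp (w * x))" for w by (rule integrable_iexp) auto
  have int2: "integrable (M \<Otimes>\<^sub>M M) (\<lambda>p. iexp (t * fst p) * iexp (r * snd p))"
    by (rule P.integrable_const_bound[of _ 1]) (auto simp: norm_mult)
  have "(\<integral>p. iexp (s * fst p) * (iexp (t * fst (snd p)) * iexp (r * snd (snd p))) \<partial>triple)
    = char M s * (\<integral>p. iexp (t * fst p) * iexp (r * snd p) \<partial>(M \<Otimes>\<^sub>M M))"
    unfolding triple_def char_def
    by (rule integral_pair_mult[OF _ _ int int2]) unfold_locales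
  also have "(\<integral>p. iexp (t * fst p) * iexp (r * snd p) \<partial>(M \<Otimes>\<^sub>M M)) = char M t * char M r"
    unfolding char_def by (rule integral_pair_mult[OF _ _ int int]) unfold_locales
  finally have "char M s * (char M t * char M r)
    = (\<integral>p. iexp (s * fst p) * (iexp (t * fst (snd p)) * iexp (r * snd (snd p))) \<partial>triple)" by simp
  thus ?thesis by (simp add: exp_add case_prod_beta' distrib_left mult.assoc)
qed

definition trilinear :: "real \<Rightarrow> real \<Rightarrow> real \<Rightarrow> real \<Rightarrow> real \<Rightarrow> complex" where
  "trilinear a b c \<delta> p = (\<integral>(x, y, z). iexp (p * (x - y)) * gauss_kernel \<delta> (a * x + b * y + c * z) \<partial>triple)"

text \<open>Fubini, with the Gaussian weight as an integrable majorant. The modulation by p (x - y)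
  becomes a pair of opposite shifts of the first two frequencies.\<close>

lemma trilinear_fourier:
  assumes "\<delta> > 0"
  shows "trilinear a b c \<delta> p =
    (CLBINT \<xi>. complex_of_real (std_normal_density (\<delta> * \<xi>)) * (char M (a * \<xi> + p) * char M (b * \<xi> - p) * char M (c * \<xi>)))"
proof -
  interpret T: prob_space triple by (rule prob_triple)
  interpret L: pair_sigma_finite lborel triple ..
  define F :: "real \<times> real \<times> real \<times> real \<Rightarrow> complex" where
    "F = (\<lambda>(\<xi>, x, y, z). complex_of_real (std_normal_density (\<delta> * \<xi>)) * iexp ((a * \<xi> + p) * x + (b * \<xi> - p) * y + c * \<xi> * z))"
  have "F \<in> borel_measurable (borel \<Otimes>\<^sub>M (borel \<Otimes>\<^sub>M (borel \<Otimes>\<^sub>M borel)))"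
    unfolding F_def case_prod_beta' by measurable
  moreover have "sets (lborel \<Otimes>\<^sub>M triple) = sets (borel \<Otimes>\<^sub>M (borel \<Otimes>\<^sub>M (borel \<Otimes>\<^sub>M borel)))"
    by (intro sets_pair_measure_cong sets_triple) simp
  ultimately have Fm [measurable]: "F \<in> borel_measurable (lborel \<Otimes>\<^sub>M triple)"
    using measurable_cong_sets[OF _ refl] by blast
  have norm: "norm (F (\<xi>, q)) = std_normal_density (\<delta> * \<xi>)" for \<xi> q
    by (cases q) (auto simp: F_def norm_mult)
  have "integrable (lborel \<Otimes>\<^sub>M triple) F"
  proof (rule L.Fubini_integrable[OF Fm])
    show "integrable lborel (\<lambda>\<xi>. \<integral>q. norm (F (\<xi>, q)) \<partial>triple)"
      unfolding norm using integrable_std_normal_scaled[OF assms] by (simp add: T.prob_space)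
    show "AE \<xi> in lborel. integrable triple (\<lambda>q. F (\<xi>, q))"
      proof (intro AE_I2)
      fix \<xi> :: real
      have "(\<lambda>q. F (\<xi>, q)) \<in> borel_measurable triple" by measurable
      thus "integrable triple (\<lambda>q. F (\<xi>, q))"
        by (intro T.integrable_const_bound[of _ "std_normal_density (\<delta> * \<xi>)"]) (auto simp: norm)
    qed
  qed
  hence "(\<integral>q. (CLBINT \<xi>. F (\<xi>, q)) \<partial>triple) = (CLBINT \<xi>. \<integral>q. F (\<xi>, q) \<partial>triple)"
    using L.Fubini_integral[of "\<lambda>\<xi> q. F (\<xi>, q)"] by simp
  also have "(\<lambda>\<xi>. \<integral>q. F (\<xi>, q) \<partial>triple)
    = (\<lambda>\<xi>. complex_of_real (std_normal_density (\<delta> * \<xi>)) * (char M (a * \<xi> + p) * char M (b * \<xi> - p) * char M (c * \<xi>)))"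
    unfolding char_prod F_def by (intro ext) (simp add: case_prod_beta')
  also have "(\<lambda>q. CLBINT \<xi>. F (\<xi>, q)) = (\<lambda>(x, y, z). iexp (p * (x - y)) * gauss_kernel \<delta> (a * x + b * y + c * z))"
  proof (intro ext, clarify)
    fix x y z
    have "(CLBINT \<xi>. F (\<xi>, x, y, z))
      = (CLBINT \<xi>. iexp (p * (x - y)) * (complex_of_real (std_normal_density (\<delta> * \<xi>)) * iexp (\<xi> * (a * x + b * y + c * z))))"
      unfolding F_def by (intro Bochner_Integration.integral_cong refl) (simp add: algebra_simps exp_add[symmetric] exp_diff)
    also have "\<dots> = iexp (p * (x - y)) * gauss_kernel \<delta> (a * x + b * y + c * z)"
      by (subst integral_mult_right_zero) (simp only: gauss_fourier[OF assms])
    finally show "(CLBINT \<xi>. F (\<xi>, x, y, z)) = iexp (p * (x - y)) * gauss_kernel \<delta> (a * x + b * y + c * z)" .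
  qed
  finally show ?thesis unfolding trilinear_def .
qed

end

section \<open>Energies and cubic moments\<close>

text \<open>Undoes the outer power in \<open>energy\<close>, so that the integral inside it is known
  exactly.\<close>

lemma ennreal_powr_eqD:
  assumes "ennreal_powr I p = ennreal K" "p > 0" "K \<ge> 0"
  shows "I = ennreal (K powr (1 / p))"
proof -
  have "I \<noteq> \<infinity>" using assms by (auto simp: ennreal_powr_def)
  hence "ennreal (enn2real I powr p) = ennreal K" using assms by (simp add: ennreal_powr_def)
  hence "enn2real I powr p = K" using assms by (simp add: ennreal_inj)
  hence "K powr (1 / p) = enn2real I" using assms by (auto simp: powr_powr)
  moreover have "I = ennreal (enn2real I)" using \<open>I \<noteq> \<infinity>\<close> by (simp add: less_top)
  ultimately show ?thesis by simp
qed

text \<open>A crude form of Young's inequality: both bases are replaced by x + y and the exponents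
  add up to 1.\<close>

lemma powr_mult_powr_le_add:
  fixes x y t :: real
  assumes "x \<ge> 0" "y \<ge> 0" "0 \<le> t" "t \<le> 1"
  shows "x powr t * y powr (1 - t) \<le> x + y"
proof -
  have "x powr t * y powr (1 - t) \<le> (x + y) powr t * (x + y) powr (1 - t)"
    using assms by (intro mult_mono powr_mono2) auto
  also have "\<dots> = x + y" using assms by (auto simp flip: powr_add)
  finally show ?thesis .
qed

lemma fourier_transform_eq_char: "fourier_transform \<mu> \<xi> = char \<mu> (- (2 * pi) * \<xi>)"
  by (simp add: fourier_transform_def char_def)

text \<open>Write \<tau> = 1 - \<theta>/2. The first energy integrand to the power \<theta>/2 is the
  modulus of the transform times |\<xi>|^(s/2 - \<theta>/2), the second to the power \<tau> is the
  squared modulus times |\<xi>|^(u - \<tau>). The product is the cubic integrand, and \<theta>/2 +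
  \<tau> = 1 is what Young's inequality requires. For \<theta> = 0 the first energy is a supremum
  and bounds one factor pointwise.\<close>

lemma fourier_transform_cube_bound:
  assumes \<mu>: "real_distribution \<mu>" and \<theta>: "0 \<le> \<theta>" "\<theta> \<le> 1"
    and K: "K\<^sub>1 > 0" "K\<^sub>2 > 0"
    and e1: "energy s \<theta> \<mu> = ennreal K\<^sub>1" and e2: "energy u (1 - \<theta> / 2) \<mu> = ennreal K\<^sub>2"
  shows "(\<integral>\<^sup>+ \<xi>. ennreal (cmod (fourier_transform \<mu> \<xi>) ^ 3 * \<bar>\<xi>\<bar> powr (s / 2 + u - 1)) \<partial>lborel)
    \<le> ennreal (sqrt K\<^sub>1 * K\<^sub>2 + K\<^sub>1 powr (1 / \<theta>) + K\<^sub>2 powr (1 / (1 - \<theta> / 2)))" (is "?I \<le> ennreal ?B")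
proof -
  interpret real_distribution \<mu> by fact
  have [measurable]: "fourier_transform \<mu> \<in> borel_measurable borel"
    unfolding fourier_transform_eq_char by measurable
  define f where "f \<xi> = cmod (fourier_transform \<mu> \<xi>)" for \<xi>
  have f: "f \<xi> \<ge> 0" for \<xi> by (simp add: f_def)
  have [measurable]: "f \<in> borel_measurable borel" unfolding f_def by measurable
  define \<tau> where "\<tau> = 1 - \<theta> / 2"
  have \<tau>: "\<tau> > 0" using \<theta> by (simp add: \<tau>_def)
  have I2: "(\<integral>\<^sup>+ \<xi>. ennreal (f \<xi> powr (2 / \<tau>) * \<bar>\<xi>\<bar> powr (u / \<tau> - 1)) \<partial>lborel) = ennreal (K\<^sub>2 powr (1 / \<tau>))"
    using e2 \<tau> K unfolding energy_def f_def \<tau>_def[symmetric] by (intro ennreal_powr_eqD) auto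
  show ?thesis
  proof (cases "\<theta> = 0")
    case True
    hence "\<tau> = 1" by (simp add: \<tau>_def)
    have le: "f \<xi> ^ 3 * \<bar>\<xi>\<bar> powr (s / 2 + u - 1) \<le> sqrt K\<^sub>1 * (f \<xi> powr 2 * \<bar>\<xi>\<bar> powr (u - 1))" for \<xi>
    proof (cases "\<xi> = 0 \<or> f \<xi> = 0")
      case False
      have "ennreal ((f \<xi>)\<^sup>2 * \<bar>\<xi>\<bar> powr s) \<le> ennreal K\<^sub>1"
        unfolding e1[symmetric] energy_def f_def using True by (auto intro!: SUP_upper)
      hence "(f \<xi>)\<^sup>2 * \<bar>\<xi>\<bar> powr s \<le> K\<^sub>1" using K by (simp add: ennreal_le_iff)
      also have "(f \<xi>)\<^sup>2 * \<bar>\<xi>\<bar> powr s = (f \<xi> * \<bar>\<xi>\<bar> powr (s / 2))\<^sup>2"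
        by (simp add: power_mult_distrib power2_eq_square flip: powr_add)
      finally have 1: "f \<xi> * \<bar>\<xi>\<bar> powr (s / 2) \<le> sqrt K\<^sub>1" by (rule real_le_rsqrt)
      have "f \<xi> ^ 3 * \<bar>\<xi>\<bar> powr (s / 2 + u - 1) = (f \<xi> * \<bar>\<xi>\<bar> powr (s / 2)) * (f \<xi> powr 2 * \<bar>\<xi>\<bar> powr (u - 1))"
        using False f[of \<xi>] by (simp add: power3_eq_cube power2_eq_square algebra_simps flip: powr_add)
      also have "\<dots> \<le> sqrt K\<^sub>1 * (f \<xi> powr 2 * \<bar>\<xi>\<bar> powr (u - 1))"
        using 1 by (rule mult_right_mono) auto
      finally show ?thesis .
    qed (use K in auto)
    have "?I \<le> (\<integral>\<^sup>+ \<xi>. ennreal (sqrt K\<^sub>1) * ennreal (f \<xi> powr 2 * \<bar>\<xi>\<bar> powr (u - 1)) \<partial>lborel)"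
      using le K by (intro nn_integral_mono) (auto simp: f_def simp flip: ennreal_mult intro!: ennreal_leI)
    also have "\<dots> = ennreal (sqrt K\<^sub>1) * ennreal K\<^sub>2"
      using I2 K by (subst nn_integral_cmult) (auto simp: \<open>\<tau> = 1\<close>)
    also have "\<dots> = ennreal (sqrt K\<^sub>1 * K\<^sub>2)" using K by (simp add: ennreal_mult)
    \<comment> \<open>Here \<open>1 / \<theta>\<close> is 0 by convention, so the middle summand of
      the bound is the constant 1; one formula thus serves every \<theta>.\<close>
    also have "\<dots> \<le> ennreal ?B" by (intro ennreal_leI) auto
    finally show ?thesis .
  next
    case False
    hence \<theta>0: "\<theta> > 0" using \<theta> by simp
    have I1: "(\<integral>\<^sup>+ \<xi>. ennreal (f \<xi> powr (2 / \<theta>) * \<bar>\<xi>\<bar> powr (s / \<theta> - 1)) \<partial>lborel) = ennreal (K\<^sub>1 powr (1 / \<theta>))"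
      using e1 \<theta>0 K unfolding energy_def f_def by (intro ennreal_powr_eqD) auto
    have le: "f \<xi> ^ 3 * \<bar>\<xi>\<bar> powr (s / 2 + u - 1)
      \<le> f \<xi> powr (2 / \<theta>) * \<bar>\<xi>\<bar> powr (s / \<theta> - 1) + f \<xi> powr (2 / \<tau>) * \<bar>\<xi>\<bar> powr (u / \<tau> - 1)" (is "_ \<le> ?x + ?y") for \<xi>
    proof (cases "\<xi> = 0 \<or> f \<xi> = 0")
      case False
      hence pos: "f \<xi> > 0" "\<bar>\<xi>\<bar> > 0" using f[of \<xi>] by auto
      have "?x powr (\<theta> / 2) = f \<xi> * \<bar>\<xi>\<bar> powr (s / 2 - \<theta> / 2)"
      proof -
        have "2 / \<theta> * (\<theta> / 2) = 1" "(s / \<theta> - 1) * (\<theta> / 2) = s / 2 - \<theta> / 2"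
          using \<theta>0 by (auto simp: left_diff_distrib)
        thus ?thesis using pos unfolding powr_mult powr_powr by (simp only:) simp
      qed
      moreover have "?y powr \<tau> = (f \<xi>)\<^sup>2 * \<bar>\<xi>\<bar> powr (u - \<tau>)"
      proof -
        have "2 / \<tau> * \<tau> = 2" "(u / \<tau> - 1) * \<tau> = u - \<tau>"
          using \<tau> by (auto simp: left_diff_distrib)
        thus ?thesis using pos unfolding powr_mult powr_powr by (simp only:) simp
      qed
      moreover have "f \<xi> ^ 3 * \<bar>\<xi>\<bar> powr (s / 2 + u - 1)
        = (f \<xi> * \<bar>\<xi>\<bar> powr (s / 2 - \<theta> / 2)) * ((f \<xi>)\<^sup>2 * \<bar>\<xi>\<bar> powr (u - \<tau>))"
        by (simp add: power3_eq_cube power2_eq_square \<tau>_def algebra_simps flip: powr_add)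
      ultimately have "f \<xi> ^ 3 * \<bar>\<xi>\<bar> powr (s / 2 + u - 1) = ?x powr (\<theta> / 2) * ?y powr (1 - \<theta> / 2)"
        by (simp add: \<tau>_def)
      also have "\<dots> \<le> ?x + ?y" using \<theta> by (intro powr_mult_powr_le_add) auto
      finally show ?thesis .
    qed auto
    have "?I \<le> (\<integral>\<^sup>+ \<xi>. ennreal (f \<xi> powr (2 / \<theta>) * \<bar>\<xi>\<bar> powr (s / \<theta> - 1))
        + ennreal (f \<xi> powr (2 / \<tau>) * \<bar>\<xi>\<bar> powr (u / \<tau> - 1)) \<partial>lborel)"
      using le by (intro nn_integral_mono) (auto simp: f_def simp flip: ennreal_plus intro!: ennreal_leI)
    also have "\<dots> = ennreal (K\<^sub>1 powr (1 / \<theta>)) + ennreal (K\<^sub>2 powr (1 / \<tau>))"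
      by (subst nn_integral_add) (auto simp: I1 I2)
    also have "\<dots> = ennreal (K\<^sub>1 powr (1 / \<theta>) + K\<^sub>2 powr (1 / \<tau>))" by simp
    also have "\<dots> \<le> ennreal ?B" using K unfolding \<tau>_def by (intro ennreal_leI) auto
    finally show ?thesis .
  qed
qed

lemma char_cube_bound:
  assumes \<mu>: "real_distribution \<mu>" and B: "B \<ge> 0"
    and le: "(\<integral>\<^sup>+ \<xi>. ennreal (cmod (fourier_transform \<mu> \<xi>) ^ 3 * \<bar>\<xi>\<bar> powr \<sigma>) \<partial>lborel) \<le> ennreal B"
  shows "(\<integral>\<^sup>+ t. ennreal (cmod (char \<mu> t) ^ 3 * \<bar>t\<bar> powr \<sigma>) \<partial>lborel) \<le> ennreal ((2 * pi) powr (\<sigma> + 1) * B)"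
proof -
  interpret real_distribution \<mu> by fact
  have [measurable]: "fourier_transform \<mu> \<in> borel_measurable borel"
    unfolding fourier_transform_eq_char by measurable
  have "(\<integral>\<^sup>+ t. ennreal (cmod (char \<mu> t) ^ 3 * \<bar>t\<bar> powr \<sigma>) \<partial>lborel)
    = ennreal (2 * pi) * (\<integral>\<^sup>+ \<xi>. ennreal (cmod (char \<mu> (- (2 * pi) * \<xi>)) ^ 3 * \<bar>- (2 * pi) * \<xi>\<bar> powr \<sigma>) \<partial>lborel)"
    by (subst nn_integral_real_affine[of _ "- (2 * pi)" 0]) auto
  also have "(\<lambda>\<xi>. ennreal (cmod (char \<mu> (- (2 * pi) * \<xi>)) ^ 3 * \<bar>- (2 * pi) * \<xi>\<bar> powr \<sigma>))
    = (\<lambda>\<xi>. ennreal ((2 * pi) powr \<sigma>) * ennreal (cmod (fourier_transform \<mu> \<xi>) ^ 3 * \<bar>\<xi>\<bar> powr \<sigma>))"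
    by (intro ext) (simp add: fourier_transform_eq_char abs_mult powr_mult mult_ac flip: ennreal_mult)
  also have "(\<integral>\<^sup>+ \<xi>. ennreal ((2 * pi) powr \<sigma>) * ennreal (cmod (fourier_transform \<mu> \<xi>) ^ 3 * \<bar>\<xi>\<bar> powr \<sigma>) \<partial>lborel)
    = ennreal ((2 * pi) powr \<sigma>) * (\<integral>\<^sup>+ \<xi>. ennreal (cmod (fourier_transform \<mu> \<xi>) ^ 3 * \<bar>\<xi>\<bar> powr \<sigma>) \<partial>lborel)"
    by (rule nn_integral_cmult) measurable
  also have "ennreal (2 * pi) * (ennreal ((2 * pi) powr \<sigma>) * (\<integral>\<^sup>+ \<xi>. ennreal (cmod (fourier_transform \<mu> \<xi>) ^ 3 * \<bar>\<xi>\<bar> powr \<sigma>) \<partial>lborel))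
    \<le> ennreal (2 * pi) * (ennreal ((2 * pi) powr \<sigma>) * ennreal B)"
    by (intro mult_left_mono le) auto
  also have "\<dots> = ennreal ((2 * pi) powr (\<sigma> + 1) * B)"
    using B by (simp add: powr_add mult_ac flip: ennreal_mult)
  finally show ?thesis .
qed

text \<open>The Jacobian is 1 / |a| \<le> 1. In the application the coefficients are nonzero
  integers, so substitutions never increase the integrals.\<close>

lemma nn_integral_affine_le:
  fixes g :: "real \<Rightarrow> ennreal"
  assumes [measurable]: "g \<in> borel_measurable borel" and a: "\<bar>a\<bar> \<ge> 1"
  shows "(\<integral>\<^sup>+ x. g (a * x + p) \<partial>lborel) \<le> (\<integral>\<^sup>+ x. g x \<partial>lborel)"
proof -
  have "1 * (\<integral>\<^sup>+ x. g (p + a * x) \<partial>lborel) \<le> ennreal \<bar>a\<bar> * (\<integral>\<^sup>+ x. g (p + a * x) \<partial>lborel)"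
    using a by (intro mult_right_mono) (auto simp flip: ennreal_1)
  also have "\<dots> = (\<integral>\<^sup>+ x. g x \<partial>lborel)" using a by (subst nn_integral_real_affine[of g a p]) auto
  finally show ?thesis by (simp add: add.commute)
qed

text \<open>The product is at most the cube of its largest factor; the sharp factor 1/3 of the mean
  inequality is given away.\<close>

lemma mult3_le_cubes:
  fixes x y z :: real
  assumes "x \<ge> 0" "y \<ge> 0" "z \<ge> 0"
  shows "x * y * z \<le> x ^ 3 + y ^ 3 + z ^ 3"
proof -
  define m where "m = max x (max y z)"
  have "x * y * z \<le> m * m * m" unfolding m_def using assms by (intro mult_mono) auto
  also have "m * m * m = m ^ 3" by (simp add: power3_eq_cube)
  also have "m = x \<or> m = y \<or> m = z" unfolding m_def by linarith
  hence "m ^ 3 \<le> x ^ 3 + y ^ 3 + z ^ 3" using assms zero_le_power[of x 3] zero_le_power[of y 3] zero_le_power[of z 3] by auto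
  finally show ?thesis .
qed

lemma exists_large_powr_small:
  fixes \<sigma> \<eta> D :: real
  assumes "\<sigma> > 0" "\<eta> > 0" "D \<ge> 0"
  obtains R where "R > 0" "D * R powr - \<sigma> \<le> \<eta>"
proof
  \<comment> \<open>D + 1 in place of D covers the case D = 0.\<close>
  define R where "R = ((D + 1) / \<eta>) powr (1 / \<sigma>)"
  show "R > 0" using assms by (simp add: R_def)
  have "R powr - \<sigma> = \<eta> / (D + 1)" using assms by (simp add: R_def powr_powr powr_minus)
  hence "D * R powr - \<sigma> = D / (D + 1) * \<eta>" by simp
  also have "\<dots> \<le> 1 * \<eta>" using assms by (intro mult_right_mono) auto
  finally show "D * R powr - \<sigma> \<le> \<eta>" by simp
qed

section \<open>Tail estimates from a weighted cubic moment\<close>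

context
  fixes h :: "real \<Rightarrow> real" and B \<sigma> :: real
  assumes h [measurable]: "h \<in> borel_measurable borel"
    and h0: "\<And>t. 0 \<le> h t" and h1: "\<And>t. h t \<le> 1"
    and \<sigma>: "\<sigma> > 0" and B: "B \<ge> 0"
    and hB: "(\<integral>\<^sup>+ t. ennreal (h t ^ 3 * \<bar>t\<bar> powr \<sigma>) \<partial>lborel) \<le> ennreal B"
begin

text \<open>Chebyshev's argument, with the weight as the large quantity. Here h stands for the
  modulus of a characteristic function.\<close>

lemma cube_tail:
  assumes "R > 0"
  shows "(\<integral>\<^sup>+ t. ennreal (h t ^ 3 * indicator {t. R \<le> \<bar>t\<bar>} t) \<partial>lborel) \<le> ennreal (B * R powr - \<sigma>)"
proof -
  have "(\<integral>\<^sup>+ t. ennreal (h t ^ 3 * indicator {t. R \<le> \<bar>t\<bar>} t) \<partial>lborel)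
    \<le> (\<integral>\<^sup>+ t. ennreal (R powr - \<sigma>) * ennreal (h t ^ 3 * \<bar>t\<bar> powr \<sigma>) \<partial>lborel)"
  proof (intro nn_integral_mono)
    fix t
    have "h t ^ 3 * indicator {t. R \<le> \<bar>t\<bar>} t \<le> R powr - \<sigma> * (h t ^ 3 * \<bar>t\<bar> powr \<sigma>)"
    proof (cases "R \<le> \<bar>t\<bar>")
      case True
      have "1 = R powr - \<sigma> * R powr \<sigma>" using assms by (simp flip: powr_add)
      also have "\<dots> \<le> R powr - \<sigma> * \<bar>t\<bar> powr \<sigma>"
        using True assms \<sigma> by (intro mult_left_mono powr_mono2) auto
      finally have "h t ^ 3 * 1 \<le> h t ^ 3 * (R powr - \<sigma> * \<bar>t\<bar> powr \<sigma>)"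
        using h0 by (intro mult_left_mono) auto
      thus ?thesis using True by (simp add: mult_ac)
    qed (use h0 in auto)
    thus "ennreal (h t ^ 3 * indicator {t. R \<le> \<bar>t\<bar>} t) \<le> ennreal (R powr - \<sigma>) * ennreal (h t ^ 3 * \<bar>t\<bar> powr \<sigma>)"
      using h0 by (subst ennreal_mult[symmetric]) (auto intro!: ennreal_leI)
  qed
  also have "\<dots> = ennreal (R powr - \<sigma>) * (\<integral>\<^sup>+ t. ennreal (h t ^ 3 * \<bar>t\<bar> powr \<sigma>) \<partial>lborel)"
    by (rule nn_integral_cmult) measurable
  also have "\<dots> \<le> ennreal (R powr - \<sigma>) * ennreal B" by (intro mult_left_mono hB) auto
  also have "\<dots> = ennreal (B * R powr - \<sigma>)" using B by (simp add: mult.commute flip: ennreal_mult)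
  finally show ?thesis .
qed

text \<open>The weight gives no control near 0, where instead h \<le> 1 is integrated over an
  interval of length 2.\<close>

lemma cube_total: "(\<integral>\<^sup>+ t. ennreal (h t ^ 3) \<partial>lborel) \<le> ennreal (B + 2)"
proof -
  have "(\<integral>\<^sup>+ t. ennreal (h t ^ 3) \<partial>lborel)
    \<le> (\<integral>\<^sup>+ t. ennreal (h t ^ 3 * indicator {t. 1 \<le> \<bar>t\<bar>} t) + indicator {-1..1} t \<partial>lborel)"
  proof (intro nn_integral_mono)
    fix t
    have "ennreal (h t ^ 3) \<le> 1" using h0[of t] h1[of t] by (simp add: power_le_one flip: ennreal_1)
    thus "ennreal (h t ^ 3) \<le> ennreal (h t ^ 3 * indicator {t. 1 \<le> \<bar>t\<bar>} t) + indicator {-1..1} t"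
      by (cases "1 \<le> \<bar>t\<bar>") (auto simp: indicator_def)
  qed
  also have "\<dots> = (\<integral>\<^sup>+ t. ennreal (h t ^ 3 * indicator {t. 1 \<le> \<bar>t\<bar>} t) \<partial>lborel) + ennreal 2"
    by (subst nn_integral_add) auto
  also have "\<dots> \<le> ennreal B + ennreal 2" using cube_tail[of 1] by (intro add_mono) auto
  finally show ?thesis using B by simp
qed

text \<open>As all coefficients have modulus at least 1, |\<xi>| \<ge> R puts all three arguments
  into the tail, and the product is bounded by the sum of their cubes.\<close>

lemma triple_tail:
  assumes "R > 0" "\<bar>a\<bar> \<ge> 1" "\<bar>b\<bar> \<ge> 1" "\<bar>c\<bar> \<ge> 1"
  shows "(\<integral>\<^sup>+ \<xi>. ennreal (h (a * \<xi>) * h (b * \<xi>) * h (c * \<xi>) * indicator {\<xi>. R \<le> \<bar>\<xi>\<bar>} \<xi>) \<partial>lborel)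
    \<le> ennreal (3 * B * R powr - \<sigma>)"
proof -
  define g where "g t = h t ^ 3 * indicator {t. R \<le> \<bar>t\<bar>} t" for t
  have [measurable]: "g \<in> borel_measurable borel" unfolding g_def by measurable
  have g0: "g t \<ge> 0" for t using h0 by (simp add: g_def)
  have gB: "(\<integral>\<^sup>+ \<xi>. ennreal (g (d * \<xi>)) \<partial>lborel) \<le> ennreal (B * R powr - \<sigma>)" if "\<bar>d\<bar> \<ge> 1" for d
    using nn_integral_affine_le[of "\<lambda>t. ennreal (g t)" d 0] cube_tail[OF assms(1)] that
    unfolding g_def[symmetric] by (auto intro: order_trans)
  have "(\<integral>\<^sup>+ \<xi>. ennreal (h (a * \<xi>) * h (b * \<xi>) * h (c * \<xi>) * indicator {\<xi>. R \<le> \<bar>\<xi>\<bar>} \<xi>) \<partial>lborel)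
    \<le> (\<integral>\<^sup>+ \<xi>. ennreal (g (a * \<xi>)) + ennreal (g (b * \<xi>)) + ennreal (g (c * \<xi>)) \<partial>lborel)"
  proof (intro nn_integral_mono)
    fix \<xi>
    have "h (a * \<xi>) * h (b * \<xi>) * h (c * \<xi>) * indicator {\<xi>. R \<le> \<bar>\<xi>\<bar>} \<xi> \<le> g (a * \<xi>) + g (b * \<xi>) + g (c * \<xi>)"
    proof (cases "R \<le> \<bar>\<xi>\<bar>")
      case True
      have "R \<le> \<bar>d * \<xi>\<bar>" if "\<bar>d\<bar> \<ge> 1" for d
        using True mult_right_mono[OF that, of "\<bar>\<xi>\<bar>"] by (simp add: abs_mult)
      thus ?thesis using mult3_le_cubes[of "h (a * \<xi>)" "h (b * \<xi>)" "h (c * \<xi>)"] h0 assms True by (simp add: g_def)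
    qed (use g0 in auto)
    thus "ennreal (h (a * \<xi>) * h (b * \<xi>) * h (c * \<xi>) * indicator {\<xi>. R \<le> \<bar>\<xi>\<bar>} \<xi>)
      \<le> ennreal (g (a * \<xi>)) + ennreal (g (b * \<xi>)) + ennreal (g (c * \<xi>))"
      using g0 by (simp flip: ennreal_plus add: ennreal_leI)
  qed
  also have "\<dots> = (\<integral>\<^sup>+ \<xi>. ennreal (g (a * \<xi>)) \<partial>lborel) + (\<integral>\<^sup>+ \<xi>. ennreal (g (b * \<xi>)) \<partial>lborel) + (\<integral>\<^sup>+ \<xi>. ennreal (g (c * \<xi>)) \<partial>lborel)"
    by (simp add: nn_integral_add)
  also have "\<dots> \<le> ennreal (B * R powr - \<sigma>) + ennreal (B * R powr - \<sigma>) + ennreal (B * R powr - \<sigma>)"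
    using assms by (intro add_mono gB)
  also have "\<dots> = ennreal (3 * B * R powr - \<sigma>)" using B by (simp flip: ennreal_plus)
  finally show ?thesis .
qed

text \<open>For large p the arguments a \<xi> + p and c \<xi> are never both smaller than R in
  modulus, so one factor is always in its tail. In the inequality for three cubes that factor
  receives the weight l^2 and the others 1 / l: the full cubic moments are damped by l^-3, and the
  tail, multiplied by l^6, is made small by choosing R after l.\<close>

lemma shifted_triple_small:
  assumes \<eta>: "\<eta> > 0" and abc: "\<bar>a\<bar> \<ge> 1" "\<bar>b\<bar> \<ge> 1" "\<bar>c\<bar> \<ge> 1"
  obtains p where "p > 0"
    "(\<integral>\<^sup>+ \<xi>. ennreal (h (a * \<xi> + p) * h (b * \<xi> - p) * h (c * \<xi>)) \<partial>lborel) \<le> ennreal \<eta>"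
proof -
  define l where "l = 1 + 6 * (B + 2) / \<eta>"
  have l: "l \<ge> 1" using \<eta> B by (simp add: l_def)
  have l3: "3 * (B + 2) / l ^ 3 \<le> \<eta> / 2"
  proof -
    have "6 * (B + 2) / \<eta> \<le> l" by (simp add: l_def)
    also have "l \<le> l ^ 3" using l by (intro self_le_power) auto
    finally show ?thesis using \<eta> l by (simp add: field_simps)
  qed
  have "\<eta> / 2 > 0" "2 * l ^ 6 * B \<ge> 0" using \<eta> B l by auto
  with \<sigma> obtain R where R: "R > 0" "(2 * l ^ 6 * B) * R powr - \<sigma> \<le> \<eta> / 2"
    by (rule exists_large_powr_small)
  \<comment> \<open>If |c \<xi>| < R then |\<xi>| \<le> R, and therefore |a \<xi> + p| \<ge> p - |a|
    R = R.\<close>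
  define p where "p = R * (1 + \<bar>a\<bar>)"
  define g where "g t = h t ^ 3 * indicator {t. R \<le> \<bar>t\<bar>} t" for t
  define k where "k t = h t ^ 3" for t
  have [measurable]: "g \<in> borel_measurable borel" "k \<in> borel_measurable borel" unfolding g_def k_def by measurable
  have g0: "g t \<ge> 0" "k t \<ge> 0" for t using h0 by (simp_all add: g_def k_def)
  have gB: "(\<integral>\<^sup>+ \<xi>. ennreal (g (d * \<xi> + q)) \<partial>lborel) \<le> ennreal (B * R powr - \<sigma>)" if "\<bar>d\<bar> \<ge> 1" for d q
    using nn_integral_affine_le[of "\<lambda>t. ennreal (g t)" d q] cube_tail[OF R(1)] that
    unfolding g_def[symmetric] by (auto intro: order_trans)
  have kB: "(\<integral>\<^sup>+ \<xi>. ennreal (k (d * \<xi> + q)) \<partial>lborel) \<le> ennreal (B + 2)" if "\<bar>d\<bar> \<ge> 1" for d q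
    using nn_integral_affine_le[of "\<lambda>t. ennreal (k t)" d q] cube_total that
    unfolding k_def[symmetric] by (auto intro: order_trans)
  have weighted: "x * y * z \<le> l ^ 6 * x ^ 3 + (x ^ 3 + y ^ 3 + z ^ 3) / l ^ 3" if "x \<ge> 0" "y \<ge> 0" "z \<ge> 0" for x y z
  proof -
    have "x * y * z = (l\<^sup>2 * x) * (y / l) * (z / l)" using l by (simp add: power2_eq_square)
    also have "\<dots> \<le> (l\<^sup>2 * x) ^ 3 + (y / l) ^ 3 + (z / l) ^ 3" using that l by (intro mult3_le_cubes) auto
    also have "\<dots> \<le> l ^ 6 * x ^ 3 + (x ^ 3 + y ^ 3 + z ^ 3) / l ^ 3"
      using that l by (simp add: power_mult_distrib power_divide add_divide_distrib flip: power_mult)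
    finally show ?thesis .
  qed
  have le: "h (a * \<xi> + p) * h (b * \<xi> - p) * h (c * \<xi>)
    \<le> l ^ 6 * (g (a * \<xi> + p) + g (c * \<xi>)) + (k (a * \<xi> + p) + k (b * \<xi> - p) + k (c * \<xi>)) / l ^ 3" for \<xi>
  proof (cases "R \<le> \<bar>c * \<xi>\<bar>")
    case True
    have "h (c * \<xi>) * h (b * \<xi> - p) * h (a * \<xi> + p)
      \<le> l ^ 6 * g (c * \<xi>) + (k (c * \<xi>) + k (b * \<xi> - p) + k (a * \<xi> + p)) / l ^ 3"
      using weighted[OF h0 h0 h0] True by (simp add: g_def k_def)
    moreover have "l ^ 6 * g (a * \<xi> + p) \<ge> 0" using l g0 by simp
    ultimately show ?thesis by (simp add: algebra_simps)
  next
    case False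
    have "\<bar>\<xi>\<bar> \<le> R"
      using False mult_right_mono[OF abc(3), of "\<bar>\<xi>\<bar>"] by (simp add: abs_mult)
    hence "\<bar>a * \<xi>\<bar> \<le> \<bar>a\<bar> * R" by (simp add: abs_mult mult_left_mono)
    hence "R \<le> \<bar>a * \<xi> + p\<bar>" by (simp add: p_def algebra_simps)
    hence "h (a * \<xi> + p) * h (b * \<xi> - p) * h (c * \<xi>)
      \<le> l ^ 6 * g (a * \<xi> + p) + (k (a * \<xi> + p) + k (b * \<xi> - p) + k (c * \<xi>)) / l ^ 3"
      using weighted[OF h0 h0 h0] by (simp add: g_def k_def)
    moreover have "l ^ 6 * g (c * \<xi>) \<ge> 0" using l g0 by simp
    ultimately show ?thesis by (simp add: algebra_simps)
  qed
  have "(\<integral>\<^sup>+ \<xi>. ennreal (h (a * \<xi> + p) * h (b * \<xi> - p) * h (c * \<xi>)) \<partial>lborel)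
    \<le> (\<integral>\<^sup>+ \<xi>. ennreal (l ^ 6) * (ennreal (g (a * \<xi> + p)) + ennreal (g (c * \<xi> + 0)))
      + ennreal (1 / l ^ 3) * (ennreal (k (a * \<xi> + p)) + ennreal (k (b * \<xi> + - p)) + ennreal (k (c * \<xi> + 0))) \<partial>lborel)"
  proof (intro nn_integral_mono)
    fix \<xi>
    show "ennreal (h (a * \<xi> + p) * h (b * \<xi> - p) * h (c * \<xi>))
    \<le> ennreal (l ^ 6) * (ennreal (g (a * \<xi> + p)) + ennreal (g (c * \<xi> + 0)))
      + ennreal (1 / l ^ 3) * (ennreal (k (a * \<xi> + p)) + ennreal (k (b * \<xi> + - p)) + ennreal (k (c * \<xi> + 0)))"
      using le[of \<xi>] g0 l by (simp flip: ennreal_plus ennreal_mult add: ennreal_leI)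
  qed
  also have "\<dots> = ennreal (l ^ 6) * ((\<integral>\<^sup>+ \<xi>. ennreal (g (a * \<xi> + p)) \<partial>lborel) + (\<integral>\<^sup>+ \<xi>. ennreal (g (c * \<xi> + 0)) \<partial>lborel))
      + ennreal (1 / l ^ 3) * ((\<integral>\<^sup>+ \<xi>. ennreal (k (a * \<xi> + p)) \<partial>lborel) + (\<integral>\<^sup>+ \<xi>. ennreal (k (b * \<xi> + - p)) \<partial>lborel)
        + (\<integral>\<^sup>+ \<xi>. ennreal (k (c * \<xi> + 0)) \<partial>lborel))"
    by (simp add: nn_integral_add nn_integral_cmult del: add_0_right)
  also have "\<dots> \<le> ennreal (l ^ 6) * (ennreal (B * R powr - \<sigma>) + ennreal (B * R powr - \<sigma>))
      + ennreal (1 / l ^ 3) * (ennreal (B + 2) + ennreal (B + 2) + ennreal (B + 2))"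
    using abc by (intro add_mono mult_left_mono gB kB) auto
  also have "\<dots> = ennreal ((2 * l ^ 6 * B) * R powr - \<sigma> + 3 * (B + 2) / l ^ 3)"
    using B l by (simp flip: ennreal_plus ennreal_mult add: field_simps)
  also have "\<dots> \<le> ennreal \<eta>" using R l3 by (intro ennreal_leI) linarith
  finally show ?thesis by (intro that[of p]) (use R in \<open>auto simp: p_def\<close>)
qed

end

section \<open>Lower bound and continuity of the trilinear form\<close>

lemma std_normal_density_le_1: "std_normal_density t \<le> 1"
proof -
  have "1 \<le> sqrt (2 * pi)" using pi_ge_two by simp
  hence "1 / sqrt (2 * pi) * exp (- t\<^sup>2 / 2) \<le> 1 * 1" by (intro mult_mono) auto
  thus ?thesis by (simp add: std_normal_density_def)
qed

text \<open>Of the two bounds, the quadratic one serves low frequencies, the constant one high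
  frequencies.\<close>

lemma std_normal_density_diff_le:
  assumes "\<bar>s\<bar> \<le> \<bar>t\<bar>"
  shows "\<bar>std_normal_density s - std_normal_density t\<bar> \<le> min 1 (t\<^sup>2 / 2)"
proof -
  have st: "s\<^sup>2 \<le> t\<^sup>2" using assms by (simp add: abs_le_square_iff)
  hence "exp (- t\<^sup>2 / 2) \<le> exp (- s\<^sup>2 / 2)" by simp
  hence 1: "std_normal_density t \<le> std_normal_density s"
    unfolding std_normal_density_def by (intro mult_left_mono) auto
  have "1 - t\<^sup>2 / 2 \<le> exp (- t\<^sup>2 / 2)" using exp_ge_add_one_self[of "- t\<^sup>2 / 2"] by simp
  moreover have "exp (- s\<^sup>2 / 2) \<le> 1" by simp
  ultimately have 2: "exp (- s\<^sup>2 / 2) - exp (- t\<^sup>2 / 2) \<le> t\<^sup>2 / 2" by linarith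
  have "1 \<le> sqrt (2 * pi)" using pi_ge_two by simp
  hence "1 / sqrt (2 * pi) * (exp (- s\<^sup>2 / 2) - exp (- t\<^sup>2 / 2)) \<le> 1 * (t\<^sup>2 / 2)"
    using 2 st by (intro mult_mono) auto
  hence "std_normal_density s - std_normal_density t \<le> t\<^sup>2 / 2"
    by (simp add: std_normal_density_def right_diff_distrib)
  moreover have "std_normal_density s \<le> 1" "0 \<le> std_normal_density t"
    by (auto simp: std_normal_density_le_1 normal_density_nonneg)
  ultimately show ?thesis using 1 by (intro min.boundedI) linarith+
qed

context real_distribution
begin

lemma integrable_char_triple:
  assumes "\<delta> > 0"
  shows "integrable lborel (\<lambda>\<xi>. complex_of_real (std_normal_density (\<delta> * \<xi>))
    * (char M (a * \<xi> + p) * char M (b * \<xi> - p) * char M (c * \<xi>)))"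
proof (rule Bochner_Integration.integrable_bound[OF integrable_std_normal_scaled[OF assms]])
  show "AE \<xi> in lborel. norm (complex_of_real (std_normal_density (\<delta> * \<xi>))
    * (char M (a * \<xi> + p) * char M (b * \<xi> - p) * char M (c * \<xi>))) \<le> norm (std_normal_density (\<delta> * \<xi>))"
    unfolding norm_mult using cmod_char_le_1
    by (intro AE_I2) (auto intro!: mult_left_le mult_le_one simp: mult_nonneg_nonneg)
qed measurable

lemma norm_trilinear_le:
  assumes "\<delta> > 0" "\<eta> \<ge> 0"
    and "(\<integral>\<^sup>+ \<xi>. ennreal (cmod (char M (a * \<xi> + p)) * cmod (char M (b * \<xi> - p)) * cmod (char M (c * \<xi>))) \<partial>lborel) \<le> ennreal \<eta>"
  shows "cmod (trilinear a b c \<delta> p) \<le> \<eta>"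
proof -
  have "ennreal (cmod (trilinear a b c \<delta> p))
    \<le> (\<integral>\<^sup>+ \<xi>. ennreal (cmod (complex_of_real (std_normal_density (\<delta> * \<xi>))
    * (char M (a * \<xi> + p) * char M (b * \<xi> - p) * char M (c * \<xi>)))) \<partial>lborel)"
    unfolding trilinear_fourier[OF assms(1)]
    by (rule integral_norm_bound_ennreal[OF integrable_char_triple[OF assms(1)]])
  also have "\<dots> \<le> (\<integral>\<^sup>+ \<xi>. ennreal (cmod (char M (a * \<xi> + p)) * cmod (char M (b * \<xi> - p)) * cmod (char M (c * \<xi>))) \<partial>lborel)"
    unfolding norm_mult
    by (intro nn_integral_mono ennreal_leI mult_left_le_one_le) (auto simp: std_normal_density_le_1)
  also have "\<dots> \<le> ennreal \<eta>" by fact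
  finally show ?thesis using assms(2) by (simp add: ennreal_le_iff)
qed

text \<open>Frequencies up to R contribute at most
  \<open>\<delta>\<^sub>0\<^sup>2 * R\<^sup>2 / 2\<close> on an interval of length 2 R, the others
  at most the tail of the triple product. The bound does not involve \<delta>, which makes it
  uniform over all smaller scales.\<close>

lemma trilinear_close:
  assumes \<delta>: "0 < \<delta>" "\<delta> \<le> \<delta>\<^sub>0" and R: "R > 0" and \<sigma>: "\<sigma> > 0" and B: "B \<ge> 0"
    and abc: "\<bar>a\<bar> \<ge> 1" "\<bar>b\<bar> \<ge> 1" "\<bar>c\<bar> \<ge> 1"
    and hB: "(\<integral>\<^sup>+ t. ennreal (cmod (char M t) ^ 3 * \<bar>t\<bar> powr \<sigma>) \<partial>lborel) \<le> ennreal B"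
  shows "cmod (trilinear a b c \<delta> 0 - trilinear a b c \<delta>\<^sub>0 0) \<le> \<delta>\<^sub>0\<^sup>2 * R ^ 3 + 3 * B * R powr - \<sigma>"
proof -
  have \<delta>0: "\<delta>\<^sub>0 > 0" using \<delta> by simp
  define h where "h t = cmod (char M t)" for t
  have [measurable]: "h \<in> borel_measurable borel" unfolding h_def by measurable
  have h: "0 \<le> h t" "h t \<le> 1" for t by (auto simp: h_def cmod_char_le_1)
  define G where "G \<delta> \<xi> = complex_of_real (std_normal_density (\<delta> * \<xi>))
    * (char M (a * \<xi> + 0) * char M (b * \<xi> - 0) * char M (c * \<xi>))" for \<delta> \<xi>
  have G: "integrable lborel (G \<delta>)" "integrable lborel (G \<delta>\<^sub>0)"
    unfolding G_def by (rule integrable_char_triple[OF \<delta>(1)], rule integrable_char_triple[OF \<delta>0])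
  have "ennreal (cmod (trilinear a b c \<delta> 0 - trilinear a b c \<delta>\<^sub>0 0))
    = ennreal (cmod (CLBINT \<xi>. G \<delta> \<xi> - G \<delta>\<^sub>0 \<xi>))"
    using G unfolding trilinear_fourier[OF \<delta>(1)] trilinear_fourier[OF \<delta>0] G_def[symmetric] by simp
  also have "\<dots> \<le> (\<integral>\<^sup>+ \<xi>. ennreal (cmod (G \<delta> \<xi> - G \<delta>\<^sub>0 \<xi>)) \<partial>lborel)"
    by (intro integral_norm_bound_ennreal Bochner_Integration.integrable_diff G)
  also have "\<dots> \<le> (\<integral>\<^sup>+ \<xi>. ennreal (\<delta>\<^sub>0\<^sup>2 * R\<^sup>2 / 2) * indicator {-R..R} \<xi>
      + ennreal (h (a * \<xi>) * h (b * \<xi>) * h (c * \<xi>) * indicator {\<xi>. R \<le> \<bar>\<xi>\<bar>} \<xi>) \<partial>lborel)"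
  proof (intro nn_integral_mono)
    fix \<xi>
    have st: "\<bar>\<delta> * \<xi>\<bar> \<le> \<bar>\<delta>\<^sub>0 * \<xi>\<bar>" unfolding abs_mult using \<delta> by (intro mult_right_mono) auto
    have hhh: "0 \<le> h (a * \<xi>) * h (b * \<xi>) * h (c * \<xi>)" "h (a * \<xi>) * h (b * \<xi>) * h (c * \<xi>) \<le> 1"
      using h by (auto intro!: mult_le_one mult_nonneg_nonneg)
    have key: "min 1 ((\<delta>\<^sub>0 * \<xi>)\<^sup>2 / 2) * (h (a * \<xi>) * h (b * \<xi>) * h (c * \<xi>)) \<le> (\<delta>\<^sub>0\<^sup>2 * R\<^sup>2 / 2) * indicator {-R..R} \<xi>
      + h (a * \<xi>) * h (b * \<xi>) * h (c * \<xi>) * indicator {\<xi>. R \<le> \<bar>\<xi>\<bar>} \<xi>"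
    proof (cases "R \<le> \<bar>\<xi>\<bar>")
      case True
      have "min 1 ((\<delta>\<^sub>0 * \<xi>)\<^sup>2 / 2) * (h (a * \<xi>) * h (b * \<xi>) * h (c * \<xi>)) \<le> 1 * (h (a * \<xi>) * h (b * \<xi>) * h (c * \<xi>))"
        by (intro mult_right_mono hhh) auto
      also have "\<dots> \<le> (\<delta>\<^sub>0\<^sup>2 * R\<^sup>2 / 2) * indicator {-R..R} \<xi> + h (a * \<xi>) * h (b * \<xi>) * h (c * \<xi>)"
        by simp
      finally show ?thesis using True by simp
    next
      case False
      have "min 1 ((\<delta>\<^sub>0 * \<xi>)\<^sup>2 / 2) \<le> \<delta>\<^sub>0\<^sup>2 * R\<^sup>2 / 2"
      proof -
        have "\<xi>\<^sup>2 \<le> R\<^sup>2" using False R by (intro power2_le_iff_abs_le[THEN iffD2]) auto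
        hence "(\<delta>\<^sub>0 * \<xi>)\<^sup>2 / 2 \<le> \<delta>\<^sub>0\<^sup>2 * R\<^sup>2 / 2"
          unfolding power_mult_distrib by (intro divide_right_mono mult_left_mono) auto
        thus ?thesis by linarith
      qed
      hence "min 1 ((\<delta>\<^sub>0 * \<xi>)\<^sup>2 / 2) * (h (a * \<xi>) * h (b * \<xi>) * h (c * \<xi>)) \<le> \<delta>\<^sub>0\<^sup>2 * R\<^sup>2 / 2 * 1"
        using hhh by (intro mult_mono) auto
      moreover have "indicat_real {-R..R} \<xi> = 1" using False by (auto simp: indicator_def)
      moreover have "indicat_real {\<xi>. R \<le> \<bar>\<xi>\<bar>} \<xi> = 0" using False by (auto simp: indicator_def)
      ultimately show ?thesis by simp
    qed
    have "G \<delta> \<xi> - G \<delta>\<^sub>0 \<xi> = complex_of_real (std_normal_density (\<delta> * \<xi>) - std_normal_density (\<delta>\<^sub>0 * \<xi>))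
      * (char M (a * \<xi>) * char M (b * \<xi>) * char M (c * \<xi>))"
      by (simp add: G_def left_diff_distrib)
    hence "cmod (G \<delta> \<xi> - G \<delta>\<^sub>0 \<xi>) = \<bar>std_normal_density (\<delta> * \<xi>) - std_normal_density (\<delta>\<^sub>0 * \<xi>)\<bar>
      * (h (a * \<xi>) * h (b * \<xi>) * h (c * \<xi>))"
      by (simp only: norm_mult norm_of_real h_def)
    also have "\<dots> \<le> min 1 ((\<delta>\<^sub>0 * \<xi>)\<^sup>2 / 2) * (h (a * \<xi>) * h (b * \<xi>) * h (c * \<xi>))"
      by (intro mult_right_mono std_normal_density_diff_le st hhh)
    also note key
    finally show "ennreal (cmod (G \<delta> \<xi> - G \<delta>\<^sub>0 \<xi>)) \<le> ennreal (\<delta>\<^sub>0\<^sup>2 * R\<^sup>2 / 2) * indicator {-R..R} \<xi>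
      + ennreal (h (a * \<xi>) * h (b * \<xi>) * h (c * \<xi>) * indicator {\<xi>. R \<le> \<bar>\<xi>\<bar>} \<xi>)"
      using hhh by (auto simp: indicator_def simp flip: ennreal_plus intro!: ennreal_leI)
  qed
  also have "\<dots> = ennreal (\<delta>\<^sub>0\<^sup>2 * R\<^sup>2 / 2) * emeasure lborel {-R..R}
      + (\<integral>\<^sup>+ \<xi>. ennreal (h (a * \<xi>) * h (b * \<xi>) * h (c * \<xi>) * indicator {\<xi>. R \<le> \<bar>\<xi>\<bar>} \<xi>) \<partial>lborel)"
    by (subst nn_integral_add) (auto simp: nn_integral_cmult)
  also have "\<dots> \<le> ennreal (\<delta>\<^sub>0\<^sup>2 * R\<^sup>2 / 2) * emeasure lborel {-R..R} + ennreal (3 * B * R powr - \<sigma>)"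
    using h hB \<sigma> B R abc by (intro add_left_mono triple_tail) (auto simp: h_def)
  also have "ennreal (\<delta>\<^sub>0\<^sup>2 * R\<^sup>2 / 2) * emeasure lborel {-R..R} = ennreal (\<delta>\<^sub>0\<^sup>2 * R ^ 3)"
    using R by (simp add: power2_eq_square power3_eq_cube mult_ac flip: ennreal_mult)
  also have "\<dots> + ennreal (3 * B * R powr - \<sigma>) = ennreal (\<delta>\<^sub>0\<^sup>2 * R ^ 3 + 3 * B * R powr - \<sigma>)"
    using R B by (intro ennreal_plus[symmetric]) auto
  finally show ?thesis by (rule ennreal_le_iff[THEN iffD1, rotated]) (use B R in auto)
qed

definition trilinear_real :: "real \<Rightarrow> real \<Rightarrow> real \<Rightarrow> real \<Rightarrow> real" where
  "trilinear_real a b c \<delta> = (\<integral>(x, y, z). gauss_kernel \<delta> (a * x + b * y + c * z) \<partial>triple)"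

lemma trilinear_0: "trilinear a b c \<delta> 0 = complex_of_real (trilinear_real a b c \<delta>)"
  unfolding trilinear_def trilinear_real_def by (simp add: case_prod_beta' flip: integral_complex_of_real)

lemma measurable_triple: "f \<in> borel_measurable (borel \<Otimes>\<^sub>M (borel \<Otimes>\<^sub>M borel)) \<Longrightarrow> f \<in> borel_measurable triple"
  using measurable_cong_sets[OF sets_triple refl] by blast

lemma gauss_kernel_bounds:
  assumes "\<delta> > 0" shows "0 \<le> gauss_kernel \<delta> v" "gauss_kernel \<delta> v \<le> 1 / \<delta>"
  using assms by (auto simp: gauss_kernel_def divide_right_mono)

lemma integrable_gauss_kernel_triple:
  assumes "\<delta> > 0"
  shows "integrable triple (\<lambda>(x, y, z). gauss_kernel \<delta> (a * x + b * y + c * z))"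
proof -
  interpret T: prob_space triple by (rule prob_triple)
  show ?thesis
  proof (rule T.integrable_const_bound[of _ "1 / \<delta>"])
    show "(\<lambda>(x, y, z). gauss_kernel \<delta> (a * x + b * y + c * z)) \<in> borel_measurable triple"
      unfolding gauss_kernel_def case_prod_beta' by (intro measurable_triple) measurable
  qed (use gauss_kernel_bounds[OF assms] in auto)
qed

text \<open>The kernel is nonnegative, and at least exp (-1/2) / \<delta> wherever the linear form
  is at most \<delta> in modulus.\<close>

lemma trilinear_real_ge:
  assumes \<delta>: "\<delta> > 0" and X: "X \<in> sets triple"
    and le: "\<And>x y z. (x, y, z) \<in> X \<Longrightarrow> \<bar>a * x + b * y + c * z\<bar> \<le> \<delta>"
  shows "exp (- 1 / 2) / \<delta> * measure triple X \<le> trilinear_real a b c \<delta>"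
proof -
  interpret T: prob_space triple by (rule prob_triple)
  have "exp (- 1 / 2) / \<delta> * measure triple X = (\<integral>q. exp (- 1 / 2) / \<delta> * indicator X q \<partial>triple)"
    using X by simp
  also have "\<dots> \<le> trilinear_real a b c \<delta>"
    unfolding trilinear_real_def
  proof (rule integral_mono)
    show "integrable triple (\<lambda>q. exp (- 1 / 2) / \<delta> * indicat_real X q)"
      using X by (intro integrable_mult_right T.integrable_const_bound[of _ 1]) (auto simp: indicator_def)
    fix q :: "real \<times> real \<times> real"
    obtain x y z where q: "q = (x, y, z)" by (cases q)
    have "exp (- 1 / 2) / \<delta> \<le> gauss_kernel \<delta> (a * x + b * y + c * z)" if "q \<in> X"
    proof -
      have "\<bar>(a * x + b * y + c * z) / \<delta>\<bar> \<le> 1" using le that q \<delta> by (simp add: abs_divide)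
      hence "((a * x + b * y + c * z) / \<delta>)\<^sup>2 \<le> 1" by (simp only: abs_square_le_1)
      thus ?thesis unfolding gauss_kernel_def using \<delta> by (intro divide_right_mono) auto
    qed
    thus "exp (- 1 / 2) / \<delta> * indicat_real X q \<le> (case q of (x, y, z) \<Rightarrow> gauss_kernel \<delta> (a * x + b * y + c * z))"
      unfolding q using gauss_kernel_bounds[OF \<delta>] by (auto simp: indicator_def)
  qed (rule integrable_gauss_kernel_triple[OF \<delta>])
  finally show ?thesis .
qed

lemma measure_triple_box:
  assumes "X \<in> sets borel" "Y \<in> sets borel" "Z \<in> sets borel"
  shows "measure triple (X \<times> (Y \<times> Z)) = measure M X * measure M Y * measure M Z"
proof -
  interpret P: pair_prob_space M M ..
  have "sigma_finite_measure (M \<Otimes>\<^sub>M M)" by unfold_locales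
  note times = sigma_finite_measure.emeasure_pair_measure_Times[OF this] emeasure_pair_measure_Times
  show ?thesis using assms unfolding triple_def measure_def
    by (simp add: times enn2real_mult mult.assoc)
qed

lemma AE_triple:
  assumes "AE x in M. x \<in> A" "A \<in> sets borel"
  shows "AE (x, y, z) in triple. x \<in> A \<and> y \<in> A \<and> z \<in> A"
proof -
  interpret T: prob_space triple by (rule prob_triple)
  have "prob A = 1" using assms by (subst prob_eq_1) auto
  hence "measure triple (A \<times> (A \<times> A)) = 1" 
    unfolding measure_triple_box[OF assms(2) assms(2) assms(2)] by simp
  moreover have "A \<times> (A \<times> A) \<in> sets triple" using assms unfolding sets_triple by auto
  ultimately have "AE q in triple. q \<in> A \<times> (A \<times> A)" by (subst (asm) T.prob_eq_1)
  thus ?thesis by (rule eventually_mono) auto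
qed

end

text \<open>The complement of the support is a union of open null sets, and by Lindelof's theorem
  countably many of them suffice.\<close>

lemma (in real_distribution) AE_in_support:
  assumes "measure_support M \<subseteq> A"
  shows "AE x in M. x \<in> A"
proof -
  define F where "F = {U. open U \<and> emeasure M U = 0}"
  obtain F' where F': "F' \<subseteq> F" "countable F'" "\<Union>F' = \<Union>F"
    using Lindelof[of F] by (auto simp: F_def)
  have "\<Union>F' \<in> null_sets M"
    unfolding null_sets_def using F'
    by (intro null_sets_UN'[of F' "\<lambda>x. x", simplified, unfolded null_sets_def]) (auto simp: F_def null_sets_def)
  moreover have "x \<in> A \<or> x \<in> \<Union>F'" for x
    using assms unfolding F'(3) F_def measure_support_def by (auto simp: zero_less_iff_neq_zero)
  ultimately show ?thesis by (intro AE_I'[of "\<Union>F'"]) auto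
qed

text \<open>Cells lighter than 1 / (2 N) carry at most half of the mass and no cell carries more
  than D / J, so at least N / (4 D) cells are heavy. Each pattern of heavy cells gives a box of mass
  at least (2 N)^-3 on which the linear form is at most H / J. There are at least c0 N^2 such boxes,
  of total mass at least c0 / (16 J); the kernel, of height about J / H, cancels J, and the bound is
  independent of the scale.\<close>

lemma (in real_distribution) trilinear_lower_bound:
  fixes m n :: int and J :: nat and D :: real
  assumes J: "J \<ge> 1" and D: "D > 0"
    and supp: "AE x in M. x \<in> {0..1}"
    and I: "\<And>j. prob {real_of_int j / J..<(real_of_int j + 1) / J} \<le> D / J"
    and pat: "\<And>S. S \<subseteq> {0..<int (J + 1)} \<Longrightarrow> real (card S) \<ge> 1 / (4 * D) * real (J + 1) \<Longrightarrow>
      real (card (patterns m n S)) \<ge> c0 * (real (J + 1))\<^sup>2"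
    and H: "H \<ge> \<bar>real_of_int (n - m)\<bar> + \<bar>real_of_int n\<bar> + \<bar>real_of_int m\<bar>" "H > 0"
    and m: "m \<noteq> 0" and c0: "c0 > 0"
  shows "exp (- 1 / 2) * c0 / (16 * H) \<le> trilinear_real (real_of_int (n - m)) (- real_of_int n) (real_of_int m) (H / J)"
proof -
  interpret T: prob_space triple by (rule prob_triple)
  \<comment> \<open>The cells are half open, so one more than J is needed to catch the point
    1.\<close>
  define N where "N = J + 1"
  have N: "N > 0" "real N \<le> 2 * real J" using J by (auto simp: N_def)
  define I where "I j = {real_of_int j / J..<(real_of_int j + 1) / J}" for j :: int
  define w where "w j = prob (I j)" for j
  have Im [measurable]: "I j \<in> sets borel" for j by (simp add: I_def)
  have J0: "real J > 0" using J by simp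
  have disj: "i = j" if "x \<in> I i" "x \<in> I j" for x i j
  proof -
    have "real_of_int k \<le> x * J" "x * J < real_of_int k + 1" if "x \<in> I k" for k
      using that J0 by (auto simp: I_def field_simps)
    from this[OF that(1)] this[OF that(2)] show "i = j" by linarith
  qed
  have cover: "x \<in> (\<Union>j\<in>{0..<int N}. I j)" if "x \<in> {0..1}" for x
  proof -
    have x: "0 \<le> x * J" "x * J \<le> J" using that J0 by (auto simp: mult_left_le_one_le)
    have "x \<in> I \<lfloor>x * J\<rfloor>" using J0 unfolding I_def by (auto simp: field_simps) linarith+
    moreover have "\<lfloor>x * J\<rfloor> \<in> {0..<int N}" using x by (auto simp: N_def floor_less_iff) 
    ultimately show ?thesis by blast
  qed
  have "prob (\<Union>j\<in>{0..<int N}. I j) = 1"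
    by (subst prob_eq_1) (use supp cover in \<open>auto elim: eventually_mono\<close>)
  moreover have "prob (\<Union>j\<in>{0..<int N}. I j) = (\<Sum>j\<in>{0..<int N}. w j)"
    unfolding w_def using disj by (intro finite_measure_finite_Union) (auto simp: disjoint_family_on_def)
  ultimately have sum1: "(\<Sum>j\<in>{0..<int N}. w j) = 1" by simp
  define S where "S = {j\<in>{0..<int N}. w j \<ge> 1 / (2 * N)}"
  have S: "S \<subseteq> {0..<int N}" "finite S" by (auto simp: S_def)
  have "1 = (\<Sum>j\<in>S. w j) + (\<Sum>j\<in>{0..<int N} - S. w j)"
    using sum.subset_diff[OF S(1) finite_atLeastLessThan_int, of w] unfolding sum1 by linarith
  also have "(\<Sum>j\<in>{0..<int N} - S. w j) \<le> (\<Sum>j\<in>{0..<int N} - S. 1 / (2 * N))"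
    by (intro sum_mono) (auto simp: S_def)
  also have "\<dots> \<le> (\<Sum>j\<in>{0..<int N}. 1 / (2 * N))" by (intro sum_mono2) auto
  also have "\<dots> = 1 / 2" using N by simp
  also have "(\<Sum>j\<in>S. w j) \<le> (\<Sum>j\<in>S. D / J)" unfolding w_def I_def by (intro sum_mono I)
  also have "\<dots> = real (card S) * (D / J)" by simp
  finally have "1 / 2 \<le> real (card S) * (D / J)" by linarith
  hence "real J / (2 * D) \<le> real (card S)" using D J0 by (simp add: field_simps)
  moreover have "1 / (4 * D) * real N \<le> real J / (2 * D)" using N D by (simp add: field_simps)
  ultimately have "1 / (4 * D) * real N \<le> real (card S)" by linarith
  hence patS: "c0 * (real N)\<^sup>2 \<le> real (card (patterns m n S))"
    unfolding N_def by (rule pat[OF S(1)[unfolded N_def]])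
  define Q where "Q = (\<lambda>(x, k). I x \<times> (I (x - m * k) \<times> I (x - n * k)))"
  have finp: "finite (patterns m n S)" by (rule finite_subset[OF patterns_subset[OF m S(1)]]) simp
  have Qm: "Q p \<in> sets triple" for p unfolding Q_def sets_triple by (cases p) auto
  define X where "X = (\<Union>p\<in>patterns m n S. Q p)"
  have Xm: "X \<in> sets triple" unfolding X_def using finp Qm by auto
  \<comment> \<open>The first two cells determine x and x - m k, hence k because m is
    nonzero.\<close>
  have "disjoint_family_on Q (patterns m n S)"
    unfolding disjoint_family_on_def
  proof (intro ballI impI, rule ccontr)
    fix p p' assume "p \<noteq> p'" "Q p \<inter> Q p' \<noteq> {}"
    then obtain q where q: "q \<in> Q p" "q \<in> Q p'" by blast
    obtain x k x' k' where pp: "p = (x, k)" "p' = (x', k')" by (cases p, cases p')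
    obtain y z v where "q = (y, z, v)" by (cases q)
    with q have yz: "y \<in> I x" "y \<in> I x'" "z \<in> I (x - m * k)" "z \<in> I (x' - m * k')"
      unfolding Q_def pp by auto
    have "x = x'" "x - m * k = x' - m * k'" using disj yz by blast+
    with m have "p = p'" by (simp add: pp)
    with \<open>p \<noteq> p'\<close> show False by simp
  qed
  hence "measure triple X = (\<Sum>p\<in>patterns m n S. measure triple (Q p))"
    unfolding X_def using finp Qm by (intro T.finite_measure_finite_Union) auto
  also have "\<dots> \<ge> (\<Sum>p\<in>patterns m n S. (1 / (2 * N)) ^ 3)"
  proof (intro sum_mono)
    fix p assume p: "p \<in> patterns m n S"
    then obtain x k where xk: "p = (x, k)" "x \<in> S" "x - m * k \<in> S" "x - n * k \<in> S" by (auto simp: patterns_def)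
    have "1 / (2 * N) * (1 / (2 * N)) * (1 / (2 * N)) \<le> w x * w (x - m * k) * w (x - n * k)"
      using xk N by (intro mult_mono) (auto simp: S_def w_def)
    thus "(1 / (2 * N)) ^ 3 \<le> measure triple (Q p)"
      unfolding xk(1) Q_def by (simp add: measure_triple_box Im power3_eq_cube w_def)
  qed
  finally have "real (card (patterns m n S)) * (1 / (2 * N)) ^ 3 \<le> measure triple X" by simp
  moreover have "c0 * (real N)\<^sup>2 * (1 / (2 * N)) ^ 3 \<le> real (card (patterns m n S)) * (1 / (2 * N)) ^ 3"
    using patS by (intro mult_right_mono) auto
  moreover have "c0 * (real N)\<^sup>2 * (1 / (2 * N)) ^ 3 = c0 / (8 * N)"
    using N by (simp add: power3_eq_cube power2_eq_square field_simps)
  moreover have "c0 / (16 * J) \<le> c0 / (8 * N)" using N c0 J0 by (intro divide_left_mono) auto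
  ultimately have X: "c0 / (16 * J) \<le> measure triple X" by linarith
  have "exp (- 1 / 2) / (H / J) * (c0 / (16 * J)) \<le> exp (- 1 / 2) / (H / J) * measure triple X"
    using X H by (intro mult_left_mono) auto
  also have "\<dots> \<le> trilinear_real (real_of_int (n - m)) (- real_of_int n) (real_of_int m) (H / J)"
  proof (rule trilinear_real_ge[OF _ Xm])
    show "0 < H / J" using H J0 by simp
    fix y z v assume "(y, z, v) \<in> X"
    then obtain x k where xk: "y \<in> I x" "z \<in> I (x - m * k)" "v \<in> I (x - n * k)"
      unfolding X_def Q_def by auto
    have frac: "\<exists>e. 0 \<le> e \<and> e \<le> 1 \<and> y * J = real_of_int j + e" if "y \<in> I j" for y j
      using that J0 by (intro exI[of _ "y * J - real_of_int j"]) (auto simp: I_def field_simps)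
    obtain e1 e2 e3 where e: "0 \<le> e1" "e1 \<le> 1" "y * J = real_of_int x + e1"
        "0 \<le> e2" "e2 \<le> 1" "z * J = real_of_int (x - m * k) + e2"
        "0 \<le> e3" "e3 \<le> 1" "v * J = real_of_int (x - n * k) + e3"
      using frac[OF xk(1)] frac[OF xk(2)] frac[OF xk(3)] by blast
    have "(real_of_int (n - m) * y + - real_of_int n * z + real_of_int m * v) * J
      = real_of_int (n - m) * (y * J) + - real_of_int n * (z * J) + real_of_int m * (v * J)"
      by (simp add: algebra_simps)
    \<comment> \<open>The integer parts cancel: (n - m) x - n (x - m k) + m (x - n k) = 0.\<close>
    also have "\<dots> = real_of_int (n - m) * e1 + - real_of_int n * e2 + real_of_int m * e3"
      unfolding e by (simp add: algebra_simps)
    finally have "\<bar>(real_of_int (n - m) * y + - real_of_int n * z + real_of_int m * v) * J\<bar>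
      = \<bar>real_of_int (n - m) * e1 + - real_of_int n * e2 + real_of_int m * e3\<bar>" by simp
    also have "\<dots> \<le> \<bar>real_of_int (n - m) * e1\<bar> + \<bar>- real_of_int n * e2\<bar> + \<bar>real_of_int m * e3\<bar>" by linarith
    also have "\<dots> \<le> \<bar>real_of_int (n - m)\<bar> * 1 + \<bar>real_of_int n\<bar> * 1 + \<bar>real_of_int m\<bar> * 1"
      unfolding abs_mult using e by (intro add_mono mult_mono) auto
    also have "\<dots> \<le> H" using H by simp
    finally have "\<bar>real_of_int (n - m) * y + - real_of_int n * z + real_of_int m * v\<bar> * J \<le> H"
      by (simp add: abs_mult)
    thus "\<bar>real_of_int (n - m) * y + - real_of_int n * z + real_of_int m * v\<bar> \<le> H / J"
      using J0 by (simp add: field_simps)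
  qed
  also have "exp (- 1 / 2) / (H / J) * (c0 / (16 * J)) = exp (- 1 / 2) * c0 / (16 * H)"
    using J0 H by (simp add: field_simps)
  finally show ?thesis .
qed

section \<open>From lower bounds on the form to nontrivial solutions\<close>

lemma gauss_kernel_far_le:
  assumes "\<delta> > 0" "\<kappa> > 0" "\<kappa> \<le> \<bar>v\<bar>"
  shows "gauss_kernel \<delta> v \<le> 2 * \<delta> / \<kappa>\<^sup>2"
proof -
  define w where "w = (v / \<delta>)\<^sup>2 / 2"
  have "v \<noteq> 0" using assms by auto
  hence w: "w > 0" using assms by (simp add: w_def)
  \<comment> \<open>A crude estimate suffices, since only convergence to 0 with \<delta> at fixed
    \<kappa> is wanted.\<close>
  have "w \<le> exp w" using exp_ge_add_one_self[of w] by linarith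
  hence "exp (- w) \<le> 1 / w" using w by (simp add: exp_minus field_simps)
  hence "gauss_kernel \<delta> v \<le> 1 / w / \<delta>"
    unfolding gauss_kernel_def w_def using assms by (intro divide_right_mono) auto
  also have "\<dots> = 2 * \<delta> / v\<^sup>2"
    using assms \<open>v \<noteq> 0\<close> by (simp add: w_def power2_eq_square field_simps)
  also have "\<dots> \<le> 2 * \<delta> / \<kappa>\<^sup>2"
  proof -
    have "\<kappa>\<^sup>2 \<le> v\<^sup>2" using assms by (simp flip: abs_le_square_iff)
    thus ?thesis using assms \<open>v \<noteq> 0\<close> by (intro divide_left_mono) auto
  qed
  finally show ?thesis .
qed

text \<open>If all solutions in \<open>A\<close> satisfy \<open>x = y\<close>, then, as \<open>\<delta> \<rightarrow> 0\<close>, the modulation \<open>iexp (p * (x - y))\<close>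
  is invisible to the trilinear form; but for large \<open>p\<close> it makes the form small.\<close>

lemma (in real_distribution) exists_nontrivial_solution:
  assumes A: "compact A" "AE x in M. x \<in> A"
    and abc: "\<bar>a\<bar> \<ge> 1" "\<bar>b\<bar> \<ge> 1" "\<bar>c\<bar> \<ge> 1" and \<sigma>: "\<sigma> > 0" and B: "B \<ge> 0"
    and hB: "(\<integral>\<^sup>+ t. ennreal (cmod (char M t) ^ 3 * \<bar>t\<bar> powr \<sigma>) \<partial>lborel) \<le> ennreal B"
    and c0: "c0 > 0" and \<delta>0: "\<delta>\<^sub>0 > 0"
    and lower: "\<And>\<delta>. 0 < \<delta> \<Longrightarrow> \<delta> \<le> \<delta>\<^sub>0 \<Longrightarrow> c0 \<le> trilinear_real a b c \<delta>"
  shows "\<exists>x\<in>A. \<exists>y\<in>A. \<exists>z\<in>A. x \<noteq> y \<and> a * x + b * y + c * z = 0"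
proof (rule ccontr)
  assume nosol: "\<not> ?thesis"
  interpret T: prob_space triple by (rule prob_triple)
  have c08: "c0 / 8 > 0" using c0 by simp
  obtain p where p: "p > 0"
    "(\<integral>\<^sup>+ \<xi>. ennreal (cmod (char M (a * \<xi> + p)) * cmod (char M (b * \<xi> - p)) * cmod (char M (c * \<xi>))) \<partial>lborel) \<le> ennreal (c0 / 8)"
    using shifted_triple_small[of "\<lambda>t. cmod (char M t)" \<sigma> B "c0 / 8" a b c] cmod_char_le_1 hB \<sigma> B abc c08
    by (auto simp: mult.assoc)
  \<comment> \<open>For |x - y| < r the modulation differs from 1 by at most p r = 1/2, so it spares
    at least half of the kernel there.\<close>
  define r where "r = 1 / (2 * p)"
  have r: "r > 0" "p * r = 1 / 2" using p by (simp_all add: r_def)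
  define Z where "Z = (A \<times> (A \<times> A)) \<inter> {(x, y, z). r \<le> \<bar>x - y\<bar>}"
  \<comment> \<open>Compactness: under the assumption to be refuted, the linear form has no zero on
    the closed part of the triples with |x - y| \<ge> r, so it stays away from 0 there.\<close>
  obtain \<kappa> where \<kappa>: "\<kappa> > 0" "\<And>x y z. (x, y, z) \<in> Z \<Longrightarrow> \<kappa> \<le> \<bar>a * x + b * y + c * z\<bar>"
  proof (cases "Z = {}")
    case True
    thus ?thesis by (intro that[of 1]) auto
  next
    case False
    have "closed {(x, y, z :: real). r \<le> \<bar>x - y\<bar>}"
      unfolding case_prod_beta' by (intro closed_Collect_le continuous_intros)
    hence Zc: "compact Z" unfolding Z_def using A by (intro compact_Int_closed compact_Times)
    have "continuous_on Z (\<lambda>q. \<bar>a * fst q + b * fst (snd q) + c * snd (snd q)\<bar>)"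
      by (intro continuous_intros)
    from continuous_attains_inf[OF Zc False this]
    obtain q where q: "q \<in> Z" "\<And>q'. q' \<in> Z \<Longrightarrow> \<bar>a * fst q + b * fst (snd q) + c * snd (snd q)\<bar>
      \<le> \<bar>a * fst q' + b * fst (snd q') + c * snd (snd q')\<bar>" by blast
    obtain x y z where xyz: "q = (x, y, z)" by (cases q)
    have "x \<in> A" "y \<in> A" "z \<in> A" "x \<noteq> y" using q(1) r unfolding xyz Z_def by auto
    hence "a * x + b * y + c * z \<noteq> 0" using nosol by blast
    with q(2) show ?thesis unfolding xyz
      by (intro that[of "\<bar>a * x + b * y + c * z\<bar>"]) force+
  qed
  \<comment> \<open>Far from the diagonal the modulation changes the kernel by at most twice
    \<open>2 * \<delta> / \<kappa>\<^sup>2\<close>; the constant 32 brings this down to c0 /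
    8.\<close>
  define \<delta> where "\<delta> = min \<delta>\<^sub>0 (c0 * \<kappa>\<^sup>2 / 32)"
  have \<delta>: "0 < \<delta>" "\<delta> \<le> \<delta>\<^sub>0" "\<delta> \<le> c0 * \<kappa>\<^sup>2 / 32" using \<delta>0 c0 \<kappa> by (auto simp: \<delta>_def)
  have far: "4 * \<delta> / \<kappa>\<^sup>2 \<le> c0 / 8" using \<delta>(3) \<kappa>(1) by (simp add: field_simps)
  define K where "K = (\<lambda>(x, y, z). gauss_kernel \<delta> (a * x + b * y + c * z))"
  define E where "E = (\<lambda>(x, y, z :: real). iexp (p * (x - y)))"
  have K: "integrable triple K" unfolding K_def by (rule integrable_gauss_kernel_triple[OF \<delta>(1)])
  have K0: "0 \<le> K q" for q using gauss_kernel_bounds[OF \<delta>(1)] by (cases q) (simp add: K_def)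
  have [measurable]: "E \<in> borel_measurable triple"
    unfolding E_def case_prod_beta' by (intro measurable_triple) measurable
  have nE: "cmod (E q) = 1" for q by (cases q) (simp add: E_def)
  have EK: "integrable triple (\<lambda>q. E q * complex_of_real (K q))"
    by (rule Bochner_Integration.integrable_bound[OF K])
       (use borel_measurable_integrable[OF K] in \<open>auto simp: norm_mult nE\<close>)
  have cK: "integrable triple (\<lambda>q. complex_of_real (K q))" using K by simp
  have Tp: "trilinear a b c \<delta> p = (\<integral>q. E q * complex_of_real (K q) \<partial>triple)"
    unfolding trilinear_def E_def K_def case_prod_beta' by simp
  have T0: "trilinear_real a b c \<delta> = (\<integral>q. K q \<partial>triple)"
    unfolding trilinear_real_def K_def ..
  have "AE q in triple. cmod (complex_of_real (K q) - E q * complex_of_real (K q)) \<le> K q / 2 + 4 * \<delta> / \<kappa>\<^sup>2"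
    using AE_triple[OF A(2) borel_closed[OF compact_imp_closed[OF A(1)]]]
  proof eventually_elim
    case (elim q)
    obtain x y z where q: "q = (x, y, z)" by (cases q)
    have inA: "x \<in> A" "y \<in> A" "z \<in> A" using elim by (auto simp: q)
    have "complex_of_real (K q) - E q * complex_of_real (K q) = (1 - E q) * complex_of_real (K q)"
      by (simp add: algebra_simps)
    hence eq: "cmod (complex_of_real (K q) - E q * complex_of_real (K q)) = cmod (1 - E q) * K q"
      using K0 by (simp add: norm_mult)
    show ?case
    proof (cases "r \<le> \<bar>x - y\<bar>")
      case True
      hence "K q \<le> 2 * \<delta> / \<kappa>\<^sup>2"
        unfolding q K_def using inA \<kappa> by (auto simp: Z_def intro!: gauss_kernel_far_le \<delta>)
      moreover have "cmod (1 - E q) \<le> 2" using norm_triangle_ineq4[of 1 "E q"] nE by simp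
      ultimately have "cmod (1 - E q) * K q \<le> 2 * (2 * \<delta> / \<kappa>\<^sup>2)" using K0 by (intro mult_mono) auto
      thus ?thesis unfolding eq using K0[of q] by simp
    next
      case False
      have "cmod (1 - E q) = cmod (iexp (p * (x - y)) - 1)" unfolding E_def q by (simp add: norm_minus_commute)
      also have "\<dots> \<le> \<bar>p * (x - y)\<bar>" using iexp_approx1[of "p * (x - y)" 0] by simp
      also have "\<dots> \<le> p * r" unfolding abs_mult using False p by (intro mult_mono) auto
      finally have "cmod (1 - E q) * K q \<le> 1 / 2 * K q" unfolding r using K0 by (intro mult_right_mono)
      thus ?thesis unfolding eq using \<delta>(1) \<kappa>(1) by (simp add: add_increasing2)
    qed
  qed
  hence "(\<integral>q. cmod (complex_of_real (K q) - E q * complex_of_real (K q)) \<partial>triple) \<le> (\<integral>q. K q / 2 + 4 * \<delta> / \<kappa>\<^sup>2 \<partial>triple)"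
    using K EK cK by (intro integral_mono_AE) auto
  also have "\<dots> = trilinear_real a b c \<delta> / 2 + 4 * \<delta> / \<kappa>\<^sup>2"
    unfolding T0 using K T.prob_space by simp
  finally have 1: "(\<integral>q. cmod (complex_of_real (K q) - E q * complex_of_real (K q)) \<partial>triple)
    \<le> trilinear_real a b c \<delta> / 2 + 4 * \<delta> / \<kappa>\<^sup>2" .
  have diff: "complex_of_real (trilinear_real a b c \<delta>) - trilinear a b c \<delta> p
    = (\<integral>q. complex_of_real (K q) - E q * complex_of_real (K q) \<partial>triple)"
    unfolding T0 Tp using cK EK by simp
  have "cmod (complex_of_real (trilinear_real a b c \<delta>) - trilinear a b c \<delta> p)
    \<le> trilinear_real a b c \<delta> / 2 + 4 * \<delta> / \<kappa>\<^sup>2"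
    unfolding diff by (rule order_trans[OF integral_norm_bound 1])
  moreover have "cmod (trilinear a b c \<delta> p) \<le> c0 / 8"
    using c0 by (intro norm_trilinear_le \<delta> p) auto
  moreover have "trilinear_real a b c \<delta> \<le> cmod (complex_of_real (trilinear_real a b c \<delta>) - trilinear a b c \<delta> p)
    + cmod (trilinear a b c \<delta> p)"
    using norm_triangle_sub[of "complex_of_real (trilinear_real a b c \<delta>)" "trilinear a b c \<delta> p"]
    by (simp add: add.commute)
  \<comment> \<open>The form at \<delta> is at most half of itself plus c0 / 8 + c0 / 8, hence at
    most c0 / 2, against the lower bound c0.\<close>
  ultimately show False using lower[OF \<delta>(1,2)] far c0 by linarith
qed

text \<open>If A were a single point, it would have mass 1, which the ball bound forbids for small
  radii. This settles the case of equal ratios, where the linear form degenerates.\<close>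

lemma (in real_distribution) exists_two_points:
  assumes A: "AE x in M. x \<in> A" and C: "C > 0" and e: "e \<le> 1 / 2"
    and ball: "\<And>x r. r > 0 \<Longrightarrow> prob (ball x r) \<le> C * r powr (1 - e)"
  shows "\<exists>x\<in>A. \<exists>y\<in>A. x \<noteq> y"
proof (rule ccontr)
  assume no: "\<not> ?thesis"
  have "A \<noteq> {}" using A by (auto simp: AE_False)
  then obtain x where x: "A = {x}" using no by blast
  \<comment> \<open>r \<le> 1 allows lowering the exponent to 1/2, and the other bound then makes
    the right side at most 1/2.\<close>
  define r where "r = min 1 (1 / (4 * C\<^sup>2))"
  have r: "0 < r" "r \<le> 1" "r \<le> 1 / (4 * C\<^sup>2)" using C by (auto simp: r_def)
  have "prob {x} = 1" using A by (subst prob_eq_1) (auto simp: x)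
  moreover have "prob {x} \<le> prob (ball x r)" using r by (intro finite_measure_mono) auto
  ultimately have "1 \<le> C * r powr (1 - e)" using ball[OF r(1), of x] by linarith
  also have "\<dots> \<le> C * r powr (1 / 2)" using r e C by (intro mult_left_mono powr_mono') auto
  also have "\<dots> \<le> C * (1 / (4 * C\<^sup>2)) powr (1 / 2)" using r C by (intro mult_left_mono powr_mono2) auto
  also have "(1 / (4 * C\<^sup>2)) powr (1 / 2) = 1 / (2 * C)"
  proof -
    have "1 / (4 * C\<^sup>2) = (1 / (2 * C))\<^sup>2" by (simp add: power2_eq_square)
    thus ?thesis using C by (simp add: powr_half_sqrt)
  qed
  finally show False using C by simp
qed

section \<open>Choice of the constants and conclusion\<close>

lemma common_denominator:
  fixes a b :: real
  assumes "a \<in> \<rat>" "b \<in> \<rat>"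
  obtains m n q :: int where "q > 0" "a = real_of_int m / real_of_int q" "b = real_of_int n / real_of_int q"
proof -
  obtain i j :: int where a: "j > 0" "a = of_int i / of_int j" using assms(1) by (rule Rats_cases') auto
  obtain k l :: int where b: "l > 0" "b = of_int k / of_int l" using assms(2) by (rule Rats_cases') auto
  show ?thesis by (rule that[of "j * l" "i * l" "k * j"]) (use a b in auto)
qed

theorem theorem1p11:
  fixes \<gamma>\<^sub>1 \<gamma>\<^sub>2 \<theta> s u C K\<^sub>1 K\<^sub>2 :: real
  assumes "\<gamma>\<^sub>1 \<in> \<rat>" "\<gamma>\<^sub>1 \<noteq> 0" "\<gamma>\<^sub>2 \<in> \<rat>" "\<gamma>\<^sub>2 \<noteq> 0"
    and "0 \<le> \<theta>" "\<theta> \<le> 1"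
    and "s > 0" "u > 0" "s / 2 + u > 1"
    and "C > 0" "K\<^sub>1 > 0" "K\<^sub>2 > 0"
  shows "\<exists>\<epsilon>>0. \<forall>(A :: real set) (\<mu> :: real measure).
    A \<subseteq> {0..1} \<longrightarrow> compact A \<longrightarrow> supports A \<mu> \<longrightarrow>
    energy s \<theta> \<mu> = ennreal K\<^sub>1 \<longrightarrow> energy u (1 - \<theta> / 2) \<mu> = ennreal K\<^sub>2 \<longrightarrow>
    (\<exists>\<epsilon>\<^sub>0. 0 < \<epsilon>\<^sub>0 \<and> \<epsilon>\<^sub>0 \<le> \<epsilon> \<and>
      (\<forall>x r. r > 0 \<longrightarrow> measure \<mu> (ball x r) \<le> C * r powr (1 - \<epsilon>\<^sub>0))) \<longrightarrow>
    (\<exists>x t. t \<noteq> 0 \<and> {x, x - \<gamma>\<^sub>1 * t, x - \<gamma>\<^sub>2 * t} \<subseteq> A)"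
proof (cases "\<gamma>\<^sub>1 = \<gamma>\<^sub>2")
  case True
  show ?thesis
  proof (rule exI[of _ "1 / 2"], intro conjI allI impI)
    fix A :: "real set" and \<mu> :: "real measure"
    assume supp: "supports A \<mu>" and "\<exists>\<epsilon>\<^sub>0. 0 < \<epsilon>\<^sub>0 \<and> \<epsilon>\<^sub>0 \<le> 1 / 2 \<and>
      (\<forall>x r. r > 0 \<longrightarrow> measure \<mu> (ball x r) \<le> C * r powr (1 - \<epsilon>\<^sub>0))"
    then obtain e where e: "e \<le> 1 / 2" "\<And>x r. r > 0 \<Longrightarrow> measure \<mu> (ball x r) \<le> C * r powr (1 - e)" by blast
    interpret real_distribution \<mu> using supp by (simp add: supports_def)
    have "AE x in \<mu>. x \<in> A" using supp by (intro AE_in_support) (simp add: supports_def)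
    from exists_two_points[OF this assms(10) e] obtain x y where xy: "x \<in> A" "y \<in> A" "x \<noteq> y" by blast
    show "\<exists>x t. t \<noteq> 0 \<and> {x, x - \<gamma>\<^sub>1 * t, x - \<gamma>\<^sub>2 * t} \<subseteq> A"
      by (intro exI[of _ x] exI[of _ "(x - y) / \<gamma>\<^sub>1"]) (use xy assms(2) True in auto)
  qed simp
next
  case False
  obtain m n q :: int where q: "q > 0" "\<gamma>\<^sub>1 = real_of_int m / real_of_int q" "\<gamma>\<^sub>2 = real_of_int n / real_of_int q"
    using common_denominator[OF assms(1,3)] by blast
  have mn: "m \<noteq> 0" "n \<noteq> 0" "m \<noteq> n" using assms(2,4) False q by auto
  define a b c where "a = real_of_int (n - m)" and "b = - real_of_int n" and "c = real_of_int m"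
  have abc: "\<bar>a\<bar> \<ge> 1" "\<bar>b\<bar> \<ge> 1" "\<bar>c\<bar> \<ge> 1"
    unfolding a_def b_def c_def abs_minus_cancel of_int_abs[symmetric] of_int_1_le_iff using mn by linarith+
  define H where "H = \<bar>real_of_int (n - m)\<bar> + \<bar>real_of_int n\<bar> + \<bar>real_of_int m\<bar>"
  have H: "H > 0" using abc unfolding H_def a_def b_def c_def by linarith
  define \<sigma> where "\<sigma> = s / 2 + u - 1"
  have \<sigma>: "\<sigma> > 0" using assms by (simp add: \<sigma>_def)
  define B0 where "B0 = sqrt K\<^sub>1 * K\<^sub>2 + K\<^sub>1 powr (1 / \<theta>) + K\<^sub>2 powr (1 / (1 - \<theta> / 2))"
  have B0: "B0 \<ge> 0" unfolding B0_def using assms by (intro add_nonneg_nonneg) auto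
  define B where "B = (2 * pi) powr (\<sigma> + 1) * B0"
  have B: "B \<ge> 0" using B0 by (simp add: B_def)
  \<comment> \<open>The factor 2 anticipates the value of \<open>J powr \<epsilon>\<close>, so that
    D is known before J.\<close>
  define D where "D = 2 * C"
  have D: "D > 0" using assms by (simp add: D_def)
  obtain c1 N0 where c1: "c1 > 0" and pat: "\<And>N S. N \<ge> N0 \<Longrightarrow> S \<subseteq> {0..<int N} \<Longrightarrow> real (card S) \<ge> 1 / (4 * D) * real N \<Longrightarrow>
      real (card (patterns m n S)) \<ge> c1 * (real N)\<^sup>2"
    using many_patterns[OF mn, of "1 / (4 * D)"] D by (metis zero_less_divide_1_iff zero_less_mult_iff zero_less_numeral)
  \<comment> \<open>The value supplied by \<open>trilinear_lower_bound\<close>; it is free of J, so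
    R and J may be chosen in terms of it.\<close>
  define c0 where "c0 = exp (- 1 / 2) * c1 / (16 * H)"
  have c0: "c0 > 0" using c1 H by (simp add: c0_def)
  obtain R where R: "R > 0" "(3 * B) * R powr - \<sigma> \<le> c0 / 4"
    using exists_large_powr_small[of \<sigma> "c0 / 4" "3 * B"] \<sigma> c0 B by auto
  obtain J1 :: nat where J1: "real J1 > H\<^sup>2 * R ^ 3 * 4 / c0" using reals_Archimedean2 by blast
  \<comment> \<open>\<open>J1\<close> controls the low-frequency error, \<open>N0\<close> is the
    threshold for counting patterns, and the summand 2 makes ln J positive.\<close>
  define J where "J = J1 + N0 + 2"
  have J: "J \<ge> 2" "J \<ge> 1" "real J > 0" by (auto simp: J_def)
  define \<delta>\<^sub>0 where "\<delta>\<^sub>0 = H / J"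
  have \<delta>0: "\<delta>\<^sub>0 > 0" using H J by (simp add: \<delta>\<^sub>0_def)
  have \<delta>R: "\<delta>\<^sub>0\<^sup>2 * R ^ 3 \<le> c0 / 4"
  proof -
    have "H\<^sup>2 * R ^ 3 * 4 / c0 \<le> real J" using J1 by (simp add: J_def)
    also have "real J \<le> (real J)\<^sup>2" using J by (simp add: power2_eq_square)
    finally show ?thesis using c0 J by (simp add: \<delta>\<^sub>0_def power_divide field_simps)
  qed
  define \<epsilon> where "\<epsilon> = ln 2 / ln (real J)"
  have \<epsilon>: "\<epsilon> > 0" using J by (simp add: \<epsilon>_def)
  have J\<epsilon>: "real J powr \<epsilon> = 2" using J by (simp add: \<epsilon>_def powr_def)
  show ?thesis
  proof (rule exI[of _ \<epsilon>], intro conjI allI impI \<epsilon>)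
    fix A :: "real set" and \<mu> :: "real measure"
    assume A: "A \<subseteq> {0..1}" "compact A" and supp: "supports A \<mu>"
      and e1: "energy s \<theta> \<mu> = ennreal K\<^sub>1" and e2: "energy u (1 - \<theta> / 2) \<mu> = ennreal K\<^sub>2"
      and "\<exists>\<epsilon>\<^sub>0. 0 < \<epsilon>\<^sub>0 \<and> \<epsilon>\<^sub>0 \<le> \<epsilon> \<and>
      (\<forall>x r. r > 0 \<longrightarrow> measure \<mu> (ball x r) \<le> C * r powr (1 - \<epsilon>\<^sub>0))"
    then obtain \<epsilon>\<^sub>0 where \<epsilon>0: "\<epsilon>\<^sub>0 \<le> \<epsilon>" and ball: "\<And>x r. r > 0 \<Longrightarrow> measure \<mu> (ball x r) \<le> C * r powr (1 - \<epsilon>\<^sub>0)" by blast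
    have \<mu>: "real_distribution \<mu>" using supp by (simp add: supports_def)
    interpret real_distribution \<mu> by (fact \<mu>)
    have AE_A: "AE x in \<mu>. x \<in> A" using supp by (intro AE_in_support) (simp add: supports_def)
    have hB: "(\<integral>\<^sup>+ t. ennreal (cmod (char \<mu> t) ^ 3 * \<bar>t\<bar> powr \<sigma>) \<partial>lborel) \<le> ennreal B"
      unfolding B_def \<sigma>_def
      by (rule char_cube_bound[OF \<mu> B0])
         (use fourier_transform_cube_bound[OF \<mu> assms(5,6,11,12) e1 e2] in \<open>simp add: B0_def\<close>)
    have cell: "measure \<mu> {real_of_int j / J..<(real_of_int j + 1) / J} \<le> D / J" for j
    proof -
      \<comment> \<open>The ball is open, so its radius is taken as the full cell length 1 / J about
        the midpoint, which includes the left end point.\<close>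
      have "measure \<mu> {real_of_int j / J..<(real_of_int j + 1) / J} \<le> measure \<mu> (ball ((real_of_int j + 1 / 2) / J) (1 / J))"
        using J by (intro finite_measure_mono) (auto simp: ball_def dist_real_def abs_less_iff field_simps)
      also have "\<dots> \<le> C * (1 / J) powr (1 - \<epsilon>\<^sub>0)" using J by (intro ball) auto
      also have "(1 / real J) powr (1 - \<epsilon>\<^sub>0) = real J powr \<epsilon>\<^sub>0 / J"
        using J by (simp add: powr_diff powr_divide)
      also have "real J powr \<epsilon>\<^sub>0 \<le> real J powr \<epsilon>" using \<epsilon>0 J by (intro powr_mono) auto
      finally show ?thesis using J assms(10) by (simp add: J\<epsilon> D_def divide_right_mono mult.commute)
    qed
    have low: "c0 \<le> trilinear_real a b c \<delta>\<^sub>0"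
      unfolding c0_def a_def b_def c_def \<delta>\<^sub>0_def
    proof (rule trilinear_lower_bound[OF J(2) D])
      show "AE x in \<mu>. x \<in> {0..1}" by (rule eventually_mono[OF AE_A]) (use A(1) in blast)
      show "c1 * (real (J + 1))\<^sup>2 \<le> real (card (patterns m n S))"
        if "S \<subseteq> {0..<int (J + 1)}" "1 / (4 * D) * real (J + 1) \<le> real (card S)" for S
        using that by (intro pat) (auto simp: J_def)
    qed (use cell c1 mn H in \<open>auto simp: H_def\<close>)
    \<comment> \<open>Going to a smaller scale loses at most c0 / 4 from low frequencies and c0 / 4
      from high ones.\<close>
    have low2: "c0 / 2 \<le> trilinear_real a b c \<delta>" if \<delta>: "0 < \<delta>" "\<delta> \<le> \<delta>\<^sub>0" for \<delta>
    proof -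
      have "cmod (trilinear a b c \<delta> 0 - trilinear a b c \<delta>\<^sub>0 0) \<le> \<delta>\<^sub>0\<^sup>2 * R ^ 3 + 3 * B * R powr - \<sigma>"
        by (rule trilinear_close[OF \<delta> R(1) \<sigma> B abc hB])
      hence "\<bar>trilinear_real a b c \<delta> - trilinear_real a b c \<delta>\<^sub>0\<bar> \<le> c0 / 4 + c0 / 4"
        unfolding trilinear_0 of_real_diff[symmetric] norm_of_real using \<delta>R R(2) by linarith
      with low show ?thesis by linarith
    qed
    have "c0 / 2 > 0" using c0 by simp
    from exists_nontrivial_solution[OF A(2) AE_A abc \<sigma> B hB this \<delta>0 low2]
    obtain x y z where xyz: "x \<in> A" "y \<in> A" "z \<in> A" "x \<noteq> y" "a * x + b * y + c * z = 0"
      by blast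
    define t where "t = (x - y) / \<gamma>\<^sub>1"
    have y: "y = x - \<gamma>\<^sub>1 * t" using assms(2) by (simp add: t_def)
    have "real_of_int m * z = real_of_int m * x - real_of_int n * (x - y)"
      using xyz(5) by (simp add: a_def b_def c_def algebra_simps)
    hence "z = x - real_of_int n / real_of_int m * (x - y)" using mn by (simp add: field_simps)
    moreover have "\<gamma>\<^sub>2 * t = real_of_int n / real_of_int m * (x - y)" unfolding t_def q using q(1) by simp
    ultimately have "z = x - \<gamma>\<^sub>2 * t" by simp
    moreover have "t \<noteq> 0" using xyz(4) assms(2) by (simp add: t_def)
    ultimately show "\<exists>x t. t \<noteq> 0 \<and> {x, x - \<gamma>\<^sub>1 * t, x - \<gamma>\<^sub>2 * t} \<subseteq> A"
      using xyz(1-3) y by blast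
  qed
qed

end
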